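(* Let $\mathfrak{aff}_n=gl(n,\mathbb R)+\mathbb R^n$ be the real affine Lie algebra with bracket $[(A,\xi),(B,\eta)]=(AB-BA,\ A\eta\!\!\!\!\phantom{x}\!\!\!\!\,$ replaced by $A\eta-B\xi)$, i.e. $[(A,\xi),(B,\eta)]=(AB-BA,\ A\eta-B\xi)$ for $A,B\in gl(n,\mathbb R)$ and column vectors $\xi,\eta\in\mathbb R^n$. Identify $\mathfrak{aff}_n^*$ with the set of pairs $(M,v)$, $M\in gl(n,\mathbb R)$, $v$ a row vector in $(\mathbb R^n)^*$, via $\langle (M,v),(A,\xi)\rangle=\operatorname{Tr}(MA)+v\xi$. For $1\le k\le n$ and column vectors $\xi_1,\dots,\xi_k\in\mathbb R^n$ define the polynomial $$f_{\xi_1,\dots,\xi_k}(M,v)=\det\big(a_{ij}\big)_{i,j=1}^k,\qquad a_{ij}=vM^{i-1}\xi_j .$$ Then for all $k,l\in\{1,\dots,n\}$ and all $\xi_1,\dots,\xi_l,\tilde\xi_1,\dots,\tilde\xi_k\in\mathbb R^n$ one has $\{f_{\xi_1,\dots,\xi_l},f_{\tilde\xi_1,\dots,\tilde\xi_k}\}=0$ with respect to the Lie–Poisson bracket of $\mathfrak{aff}_n$, and the polynomials $f_{\xi_1,\dots,\xi_k}$ ($\xi_i\in\mathbb R^n$, $k=1,\dots,n$) generate a complete commutative subalgebra of $S(\mathfrak{aff}_n)$.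
   Context: For a finite-dimensional Lie algebra $\mathfrak g$ over a field $\mathbb K$ of characteristic zero, $S(\mathfrak g)$ denotes the algebra of polynomial functions on $\mathfrak g^*$ with the Lie–Poisson bracket $\{f,g\}(x)=\langle x,[df(x),dg(x)]\rangle$ (differentials at $x\in\mathfrak g^*$ are viewed as elements of $\mathfrak g$). The index $\operatorname{ind}\mathfrak g$ is the corank of the form $\Phi_x(\xi,\eta)=\langle x,[\xi,\eta]\rangle$ for generic $x\in\mathfrak g^*$. A Poisson-commutative subalgebra $\mathcal A\subset S(\mathfrak g)$ is complete if its transcendence degree equals $\tfrac12(\dim\mathfrak g+\operatorname{ind}\mathfrak g)$. *)

theory Defs
  imports "HOL-Analysis.Analysis"
begin

text \<open>The affine Lie algebra aff_n = gl(n,R) + R^n, realised on pairs (A, xi).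
  Its dual is realised on pairs (M, v) of the same shape, with pairing
  Tr(M A) + v xi.\<close>

type_synonym 'n aff = "(real^'n^'n) \<times> (real^'n)"

definition aff_bracket :: "'n::finite aff \<Rightarrow> 'n aff \<Rightarrow> 'n aff" where
  "aff_bracket X Y = (fst X ** fst Y - fst Y ** fst X,
                      fst X *v snd Y - fst Y *v snd X)"

definition aff_pair :: "'n::finite aff \<Rightarrow> 'n aff \<Rightarrow> real" where
  "aff_pair x X = (\<Sum>i\<in>UNIV. \<Sum>j\<in>UNIV. fst x $ i $ j * fst X $ j $ i)
                  + (\<Sum>i\<in>UNIV. snd x $ i * snd X $ i)"

definition aff_diff :: "('n::finite aff \<Rightarrow> real) \<Rightarrow> 'n aff \<Rightarrow> 'n aff" where
  "aff_diff f x = (SOME D. (f has_derivative (\<lambda>y. aff_pair y D)) (at x))"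

definition lp_bracket ::
  "('n::finite aff \<Rightarrow> real) \<Rightarrow> ('n aff \<Rightarrow> real) \<Rightarrow> 'n aff \<Rightarrow> real" where
  "lp_bracket f g x = aff_pair x (aff_bracket (aff_diff f x) (aff_diff g x))"

text \<open>Index: minimal (= generic) dimension of the kernel of Phi_x.\<close>
definition aff_index :: "'n::finite itself \<Rightarrow> nat" where
  "aff_index _ = (LEAST d. \<exists>x :: 'n aff.
      d = dim {X :: 'n aff. \<forall>Y. aff_pair x (aff_bracket X Y) = 0})"

primrec mpow :: "real^'n^'n \<Rightarrow> nat \<Rightarrow> real^'n^'n" where
  "mpow M 0 = mat 1"
| "mpow M (Suc i) = mpow M i ** M"

definition det_k :: "nat \<Rightarrow> (nat \<Rightarrow> nat \<Rightarrow> real) \<Rightarrow> real" where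
  "det_k k a = (\<Sum>p | p permutes {..<k}. of_int (sign p) * (\<Prod>i<k. a i (p i)))"

text \<open>f_{xi_1..xi_k}(M,v) = det (v M^(i-1) xi_j)_{i,j=1..k}  (0-indexed here).\<close>
definition f_poly :: "nat \<Rightarrow> (nat \<Rightarrow> real^'n) \<Rightarrow> 'n::finite aff \<Rightarrow> real" where
  "f_poly k xi x = det_k k (\<lambda>i j. snd x \<bullet> (mpow (fst x) i *v xi j))"

text \<open>Real polynomials in m variables: finitely supported coefficient functions
  on exponent vectors supported in {..<m}.\<close>
definition mpoly_coeffs :: "nat \<Rightarrow> ((nat \<Rightarrow> nat) \<Rightarrow> real) set" where
  "mpoly_coeffs m = {c. finite {\<alpha>. c \<alpha> \<noteq> 0} \<and> (\<forall>\<alpha>. c \<alpha> \<noteq> 0 \<longrightarrow> (\<forall>i\<ge>m. \<alpha> i = 0))}"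

definition mpoly_eval ::
  "nat \<Rightarrow> ((nat \<Rightarrow> nat) \<Rightarrow> real) \<Rightarrow> (nat \<Rightarrow> 'a \<Rightarrow> real) \<Rightarrow> 'a \<Rightarrow> real" where
  "mpoly_eval m c gs x = (\<Sum>\<alpha>\<in>{\<alpha>. c \<alpha> \<noteq> 0}. c \<alpha> * (\<Prod>i<m. gs i x ^ \<alpha> i))"

definition gen_alg :: "('a \<Rightarrow> real) set \<Rightarrow> ('a \<Rightarrow> real) set" where
  "gen_alg G = {mpoly_eval m c gs | m c gs. c \<in> mpoly_coeffs m \<and> (\<forall>i<m. gs i \<in> G)}"

definition alg_indep :: "nat \<Rightarrow> (nat \<Rightarrow> 'a \<Rightarrow> real) \<Rightarrow> bool" where
  "alg_indep m gs = (\<forall>c\<in>mpoly_coeffs m.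
      (\<forall>x. mpoly_eval m c gs x = 0) \<longrightarrow> (\<forall>\<alpha>. c \<alpha> = 0))"

definition trdeg :: "('a \<Rightarrow> real) set \<Rightarrow> enat" where
  "trdeg A = Sup {enat m | m. \<exists>gs. (\<forall>i<m. gs i \<in> A) \<and> alg_indep m gs}"

definition aff_poisson_commutative :: "('n::finite aff \<Rightarrow> real) set \<Rightarrow> bool" where
  "aff_poisson_commutative A = (\<forall>f\<in>A. \<forall>g\<in>A. \<forall>x. lp_bracket f g x = 0)"

definition aff_complete :: "('n::finite aff \<Rightarrow> real) set \<Rightarrow> bool" where
  "aff_complete A = (aff_poisson_commutative A \<and>
      2 * trdeg A = enat (DIM('n aff) + aff_index TYPE('n)))"

end

(* Write krow x i = v M^i. The differentials of the functions x \<mapsto> v M^i \<xi> are explicit, and the bracket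
   of two of them is a telescoping sum of terms (v M^u \<xi>)(v M^(i+j-1-u) \<eta>). Contracting it with the
   cofactors of two determinants f_poly replaces a row of one of the two matrices by an earlier row,
   so every term vanishes.

   The f_poly are functions of the Krylov matrix with rows v, vM, vM^2, ... that are invariant under
   left multiplication by unipotent lower triangular matrices. By LU decomposition of generic
   matrices they are therefore determined by their restriction to upper triangular matrices, which
   have n(n+1)/2 entries, so more elements of the algebra are dependent by a dimension count.
   Conversely every upper triangular matrix with nonzero diagonal is a Krylov matrix, and on these
   the minors with columns 1..k-1, j take arbitrary positive values. Since the index is 0,
   n(n+1)/2 is the required transcendence degree. *)

theory Submission
  imports Defs "Jordan_Normal_Form.Spectral_Radius"
begin

no_notation Matrix.vec_index (infixl "$" 100)
no_notation Matrix.scalar_prod (infix "\<bullet>" 70)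

section \<open>Determinants\<close>

lemma det_k_eq_det: "det_k k a = Determinant.det (Matrix.mat k k (\<lambda>(i,j). a i j))"
proof -
  have "(\<Prod>i<k. a i (p i)) = (\<Prod>i<k. Matrix.mat k k (\<lambda>(i,j). a i j) $$ (i, p i))"
    if "p permutes {..<k}" for p
    using permutes_in_image[OF that] by (intro prod.cong) auto
  then show ?thesis
    unfolding det_k_def Determinant.det_def dim_row_mat dim_col_mat atLeast0LessThan
    by (auto simp del: index_mat intro!: sum.cong)
qed

lemma det_k_cong: "(\<And>i j. i < k \<Longrightarrow> j < k \<Longrightarrow> a i j = b i j) \<Longrightarrow> det_k k a = det_k k b"
  unfolding det_k_eq_det by (intro arg_cong[where f = Determinant.det] eq_matI) auto

lemma det_k_identical_rows:
  assumes "i \<noteq> j" "i < k" "j < k" "\<And>c. c < k \<Longrightarrow> a i c = a j c"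
  shows "det_k k a = 0"
  unfolding det_k_eq_det
  by (rule det_identical_rows[of _ k i j]) (use assms in \<open>auto intro!: eq_vecI\<close>)

lemma det_k_identical_columns:
  assumes "i \<noteq> j" "i < k" "j < k" "\<And>r. r < k \<Longrightarrow> a r i = a r j"
  shows "det_k k a = 0"
  unfolding det_k_eq_det
  by (rule det_identical_columns[of _ k i j]) (use assms in \<open>auto intro!: eq_vecI\<close>)

lemma det_k_upper_triangular:
  assumes "\<And>i j. j < i \<Longrightarrow> i < k \<Longrightarrow> a i j = 0"
  shows "det_k k a = (\<Prod>i<k. a i i)"
  unfolding det_k_eq_det
  by (subst det_upper_triangular[of _ k])
     (use assms in \<open>auto simp: upper_triangular_def prod_list_diag_prod atLeast0LessThan\<close>)

text \<open>A lower triangular factor with unit diagonal has determinant 1. This is the source of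
  the invariance of the \<open>f_poly\<close> under adding earlier rows to later ones.\<close>

lemma det_k_unipotent_mult:
  assumes "\<And>i. i < k \<Longrightarrow> l i i = 1" "\<And>i j. i < j \<Longrightarrow> j < k \<Longrightarrow> l i j = 0"
  shows "det_k k (\<lambda>i j. \<Sum>r<k. l i r * a r j) = det_k k a"
proof -
  let ?L = "Matrix.mat k k (\<lambda>(i,j). l i j)" and ?A = "Matrix.mat k k (\<lambda>(i,j). a i j)"
  have "Matrix.mat k k (\<lambda>(i,j). \<Sum>r<k. l i r * a r j) = ?L * ?A"
    by (rule eq_matI) (auto simp: Matrix.scalar_prod_def atLeast0LessThan)
  moreover have "Determinant.det ?L = 1"
    by (subst det_lower_triangular[of k])
       (use assms in \<open>auto simp: prod_list_diag_prod intro!: prod.neutral\<close>)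
  ultimately show ?thesis
    unfolding det_k_eq_det by (simp add: Determinant.det_mult[of _ k])
qed

section \<open>Cofactors and the derivative of a determinant\<close>

text \<open>The cofactor is encoded with row \<open>i\<close> replaced by a unit vector, which
  avoids index shifts and explicit signs.\<close>

definition cof_k :: "nat \<Rightarrow> (nat \<Rightarrow> nat \<Rightarrow> real) \<Rightarrow> nat \<Rightarrow> nat \<Rightarrow> real" where
  "cof_k k a i q = det_k k (a(i := \<lambda>c. if c = q then 1 else 0))"

text \<open>Isolating the factor of row \<open>i\<close> in the Leibniz sum exhibits the linearity
  in that row.\<close>

lemma det_k_row_replace:
  assumes "i < k"
  shows "det_k k (a(i := b)) =
    (\<Sum>p | p permutes {..<k}. of_int (sign p) * (b (p i) * (\<Prod>j\<in>{..<k} - {i}. a j (p j))))"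
  unfolding det_k_def
proof (intro sum.cong refl)
  fix p
  have "(\<Prod>j<k. (a(i := b)) j (p j)) = b (p i) * (\<Prod>j\<in>{..<k} - {i}. (a(i := b)) j (p j))"
    using assms by (subst prod.remove[of _ i]) auto
  also have "(\<Prod>j\<in>{..<k} - {i}. (a(i := b)) j (p j)) = (\<Prod>j\<in>{..<k} - {i}. a j (p j))"
    by (intro prod.cong) auto
  finally show "of_int (sign p) * (\<Prod>j<k. (a(i := b)) j (p j)) =
      of_int (sign p) * (b (p i) * (\<Prod>j\<in>{..<k} - {i}. a j (p j)))" by simp
qed

lemma det_k_row_expand:
  assumes "i < k"
  shows "det_k k (a(i := b)) = (\<Sum>q<k. cof_k k a i q * b q)"
proof -
  have "(\<Sum>q<k. cof_k k a i q * b q) =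
    (\<Sum>p | p permutes {..<k}. \<Sum>q<k. of_int (sign p) *
       ((if p i = q then 1 else 0) * (\<Prod>j\<in>{..<k} - {i}. a j (p j))) * b q)"
    unfolding cof_k_def det_k_row_replace[OF assms] sum_distrib_right
    by (rule sum.swap)
  also have "\<dots> = det_k k (a(i := b))"
    unfolding det_k_row_replace[OF assms]
  proof (intro sum.cong refl)
    fix p assume "p \<in> {p. p permutes {..<k}}"
    then have "p i < k" using permutes_in_image[of p "{..<k}" i] assms by auto
    \<comment> \<open>Only the column \<open>q = p i\<close> contributes for the permutation
      \<open>p\<close>.\<close>
    have "(\<Sum>q<k. of_int (sign p) * ((if p i = q then 1 else 0) * (\<Prod>j\<in>{..<k} - {i}. a j (p j))) * b q)
      = (\<Sum>q<k. if q = p i then of_int (sign p) * (b (p i) * (\<Prod>j\<in>{..<k} - {i}. a j (p j))) else 0)"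
      by (intro sum.cong) auto
    then show "(\<Sum>q<k. of_int (sign p) * ((if p i = q then 1 else 0) * (\<Prod>j\<in>{..<k} - {i}. a j (p j))) * b q)
      = of_int (sign p) * (b (p i) * (\<Prod>j\<in>{..<k} - {i}. a j (p j)))"
      using \<open>p i < k\<close> by simp
  qed
  finally show ?thesis by simp
qed

text \<open>For \<open>u \<noteq> i\<close> the sum is a determinant in which row \<open>u\<close>
  occurs twice. This vanishing kills the Poisson brackets.\<close>

lemma sum_cof_k_row:
  assumes "i < k" "u < k"
  shows "(\<Sum>q<k. cof_k k a i q * a u q) = (if u = i then det_k k a else 0)"
proof (cases "u = i")
  case True
  then show ?thesis using det_k_row_expand[OF assms(1), of a "a i"] by simp
next
  case False
  then have "det_k k (a(i := a u)) = 0"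
    using assms by (intro det_k_identical_rows[of i u]) auto
  then show ?thesis using False det_k_row_expand[OF assms(1), of a "a u"] by simp
qed

text \<open>Jacobi's formula: the product rule differentiates one row at a time, and each resulting
  determinant is expanded along that row.\<close>

lemma has_derivative_det_k:
  fixes a :: "nat \<Rightarrow> nat \<Rightarrow> 'a::real_normed_vector \<Rightarrow> real"
  assumes "\<And>i j. i < k \<Longrightarrow> j < k \<Longrightarrow> (a i j has_derivative a' i j) (at x)"
  shows "((\<lambda>x. det_k k (\<lambda>i j. a i j x)) has_derivative
    (\<lambda>y. \<Sum>i<k. \<Sum>q<k. cof_k k (\<lambda>i j. a i j x) i q * a' i q y)) (at x)"
proof -
  have "((\<lambda>x. det_k k (\<lambda>i j. a i j x)) has_derivative
    (\<lambda>y. \<Sum>p | p permutes {..<k}. of_int (sign p) *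
       (\<Sum>i<k. a' i (p i) y * (\<Prod>j\<in>{..<k} - {i}. a j (p j) x)))) (at x)"
    unfolding det_k_def
    using permutes_in_image[of _ "{..<k}"]
    by (intro has_derivative_sum has_derivative_mult_right has_derivative_prod assms) auto
  moreover have "(\<Sum>p | p permutes {..<k}. of_int (sign p) *
       (\<Sum>i<k. a' i (p i) y * (\<Prod>j\<in>{..<k} - {i}. a j (p j) x))) =
       (\<Sum>i<k. \<Sum>q<k. cof_k k (\<lambda>i j. a i j x) i q * a' i q y)" for y
  proof -
    have "(\<Sum>p | p permutes {..<k}. of_int (sign p) *
       (\<Sum>i<k. a' i (p i) y * (\<Prod>j\<in>{..<k} - {i}. a j (p j) x))) =
       (\<Sum>i<k. det_k k ((\<lambda>i j. a i j x)(i := \<lambda>q. a' i q y)))"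
      by (simp add: sum_distrib_left det_k_row_replace sum.swap[of _ _ "{..<k}"])
    then show ?thesis by (simp add: det_k_row_expand)
  qed
  ultimately show ?thesis by simp
qed

section \<open>Elimination and generic shifts\<close>

text \<open>Cramer's rule for the elimination step: expanding along the last column, the coefficients do
  not depend on the entries of that column, and the resulting row vanishes on the first
  \<open>i\<close> columns because there two columns coincide.\<close>

lemma LU_row:
  assumes "det_k i w \<noteq> 0"
  obtains l where "l i = 1" "\<And>c. c < i \<Longrightarrow> (\<Sum>r<Suc i. l r * w r c) = (0::real)"
proof -
  \<comment> \<open>Column \<open>c\<close> is put in the last position \<open>i\<close>; deleting
    that column makes the cofactors independent of \<open>c\<close>.\<close>
  define A where "A c = Matrix.mat (Suc i) (Suc i) (\<lambda>(r,j). w r (if j = i then c else j))" for c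
  define C where "C r = cofactor (A i) r i" for r
  have C: "cofactor (A c) r i = C r" for c r
    unfolding C_def Determinant.cofactor_def A_def mat_delete_def
    by (intro arg_cong2[where f = "(*)"] arg_cong[where f = Determinant.det] eq_matI) auto
  have ex: "(\<Sum>r<Suc i. C r * w r c) = det_k (Suc i) (\<lambda>r j. w r (if j = i then c else j))" for c
    unfolding det_k_eq_det A_def[symmetric]
    by (subst laplace_expansion_column[of _ "Suc i" i], auto simp: C mult.commute)
       (auto simp: A_def intro!: sum.cong)
  \<comment> \<open>The diagonal sign is positive, and deleting the last row and column leaves the
    leading minor of size \<open>i\<close>.\<close>
  have "C i = det_k i w"
    unfolding C_def Determinant.cofactor_def A_def mat_delete_def det_k_eq_det
    by (auto intro!: arg_cong[where f = Determinant.det] eq_matI simp flip: power2_eq_square mult_2)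
  have zero: "(\<Sum>r<Suc i. C r * w r c) = 0" if "c < i" for c
    unfolding ex using that by (intro det_k_identical_columns[of i c]) auto
  show ?thesis
  proof (rule that[of "\<lambda>r. C r / det_k i w"])
    fix c assume "c < i"
    have "(\<Sum>r<Suc i. C r / det_k i w * w r c) = (\<Sum>r<Suc i. C r * w r c) / det_k i w"
      unfolding sum_divide_distrib by (rule sum.cong) auto
    then show "(\<Sum>r<Suc i. C r / det_k i w * w r c) = 0"
      unfolding zero[OF \<open>c < i\<close>] by simp
  qed (use assms \<open>C i = det_k i w\<close> in simp)
qed

text \<open>As a function of \<open>t\<close> this is the characteristic polynomial of the negated
  matrix, so its zeros are finitely many eigenvalues.\<close>

lemma finite_det_k_shift: "finite {t. det_k k (\<lambda>i j. w i j + (if i = j then t else 0)) = 0}"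
proof -
  define A where "A = Matrix.mat k k (\<lambda>(i,j). - w i j)"
  have A: "A \<in> carrier_mat k k" by (simp add: A_def)
  have eq: "det_k k (\<lambda>i j. w i j + (if i = j then t else 0)) = poly (char_poly A) t" for t
    unfolding det_k_eq_det char_poly_matrix[OF A]
    by (rule arg_cong[where f = Determinant.det], rule eq_matI)
       (auto simp: A_def char_matrix_def)
  show ?thesis
    unfolding eq spectrum_root_char_poly[OF A, symmetric] by (rule card_finite_spectrum(1)[OF A])
qed

section \<open>Algebras of functions and algebraic dependence\<close>

text \<open>A property closed under these operations passes from generators to the generated
  algebra; later arguments instantiate the locale with such properties.\<close>

locale fun_algebra =
  fixes S :: "('a \<Rightarrow> real) set"
  assumes const: "(\<lambda>x. c) \<in> S"
    and add: "f \<in> S \<Longrightarrow> g \<in> S \<Longrightarrow> (\<lambda>x. f x + g x) \<in> S"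
    and mult: "f \<in> S \<Longrightarrow> g \<in> S \<Longrightarrow> (\<lambda>x. f x * g x) \<in> S"
begin

lemma sum: "(\<And>i. i \<in> I \<Longrightarrow> f i \<in> S) \<Longrightarrow> (\<lambda>x. \<Sum>i\<in>I. f i x) \<in> S"
  by (induction I rule: infinite_finite_induct) (auto intro: const add)

lemma prod: "(\<And>i. i \<in> I \<Longrightarrow> f i \<in> S) \<Longrightarrow> (\<lambda>x. \<Prod>i\<in>I. f i x) \<in> S"
  by (induction I rule: infinite_finite_induct) (auto intro: const mult)

lemma power: "f \<in> S \<Longrightarrow> (\<lambda>x. f x ^ k) \<in> S"
  by (induction k) (auto intro: const mult)

lemma det_k:
  assumes "\<And>i j. i < k \<Longrightarrow> j < k \<Longrightarrow> a i j \<in> S"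
  shows "(\<lambda>x. det_k k (\<lambda>i j. a i j x)) \<in> S"
  unfolding det_k_def using permutes_in_image[of _ "{..<k}"]
  by (intro sum mult const prod assms) auto

lemma mpoly_eval: "(\<And>i. i < m \<Longrightarrow> gs i \<in> S) \<Longrightarrow> mpoly_eval m c gs \<in> S"
  unfolding mpoly_eval_def by (intro sum mult const prod power) auto

lemma gen_alg_subset: "G \<subseteq> S \<Longrightarrow> gen_alg G \<subseteq> S"
  unfolding gen_alg_def using mpoly_eval by blast

end

text \<open>The intersection makes closure under sums and products immediate, unlike the coefficient
  functions in \<open>gen_alg\<close>.\<close>

definition alg_hull :: "('a \<Rightarrow> real) set \<Rightarrow> ('a \<Rightarrow> real) set" where
  "alg_hull G = \<Inter>{S. fun_algebra S \<and> G \<subseteq> S}"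

lemma alg_hull_subset: "fun_algebra S \<Longrightarrow> G \<subseteq> S \<Longrightarrow> alg_hull G \<subseteq> S"
  unfolding alg_hull_def by blast

lemma subset_alg_hull: "G \<subseteq> alg_hull G"
  unfolding alg_hull_def by blast

lemma fun_algebra_alg_hull: "fun_algebra (alg_hull G)"
  by standard (auto simp: alg_hull_def intro: fun_algebra.const fun_algebra.add fun_algebra.mult)

lemma subset_gen_alg: "G \<subseteq> gen_alg G"
proof
  fix g assume "g \<in> G"
  define e :: "nat \<Rightarrow> nat" where "e = (\<lambda>i. if i = 0 then 1 else 0)"
  define c :: "(nat \<Rightarrow> nat) \<Rightarrow> real" where "c = (\<lambda>\<alpha>. if \<alpha> = e then 1 else 0)"
  have supp: "{\<alpha>. c \<alpha> \<noteq> 0} = {e}" by (auto simp: c_def)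
  have "c \<in> mpoly_coeffs 1" unfolding mpoly_coeffs_def supp by (auto simp: c_def e_def)
  moreover have "mpoly_eval 1 c (\<lambda>_. g) = g"
    unfolding mpoly_eval_def supp by (simp add: c_def e_def)
  ultimately show "g \<in> gen_alg G" unfolding gen_alg_def using \<open>g \<in> G\<close>
    by (intro CollectI exI[of _ 1] exI[of _ c] exI[of _ "\<lambda>_. g"]) simp
qed

section \<open>Algebraic independence from arbitrary positive values\<close>

lemma base_expansion_less:
  fixes \<alpha> :: "nat \<Rightarrow> nat"
  assumes "\<And>i. i < m \<Longrightarrow> \<alpha> i < B"
  shows "(\<Sum>i<m. B ^ i * \<alpha> i) < B ^ m"
  using assms
proof (induction m)
  case (Suc m)
  have "(\<Sum>i<Suc m. B ^ i * \<alpha> i) < B ^ m + B ^ m * \<alpha> m" using Suc by simp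
  also have "\<dots> = B ^ m * Suc (\<alpha> m)" by simp
  also have "\<dots> \<le> B ^ m * B" using Suc.prems[of m] by (intro mult_le_mono2) auto
  finally show ?case by (simp add: mult.commute)
qed simp

lemma base_expansion_inj:
  fixes \<alpha> \<beta> :: "nat \<Rightarrow> nat"
  assumes "\<And>i. i < m \<Longrightarrow> \<alpha> i < B" "\<And>i. i < m \<Longrightarrow> \<beta> i < B"
    and "(\<Sum>i<m. B ^ i * \<alpha> i) = (\<Sum>i<m. B ^ i * \<beta> i)" and "i < m"
  shows "\<alpha> i = \<beta> i"
  using assms
proof (induction m)
  case (Suc m)
  have l: "(\<Sum>i<m. B ^ i * \<alpha> i) < B ^ m" "(\<Sum>i<m. B ^ i * \<beta> i) < B ^ m"
    using Suc.prems by (auto intro!: base_expansion_less)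
  have pos: "B ^ m > 0" using l(1) by linarith
  have eq: "(\<Sum>i<m. B ^ i * \<alpha> i) + B ^ m * \<alpha> m = (\<Sum>i<m. B ^ i * \<beta> i) + B ^ m * \<beta> m"
    using Suc.prems(3) by simp
  from arg_cong[OF eq, of "\<lambda>z. z div B ^ m"] have "\<alpha> m = \<beta> m" using l pos by simp
  moreover from this eq have "(\<Sum>i<m. B ^ i * \<alpha> i) = (\<Sum>i<m. B ^ i * \<beta> i)" by simp
  ultimately show ?case using Suc by (cases "i = m") auto
qed simp

text \<open>Kronecker substitution \<open>y\<^sub>i = t ^ B ^ i\<close> reduces the claim to a polynomial in one variable.\<close>

lemma alg_indepI_positive:
  assumes "\<And>y :: nat \<Rightarrow> real. (\<And>i. y i > 0) \<Longrightarrow> \<exists>x. \<forall>i<m. gs i x = y i"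
  shows "alg_indep m gs"
  unfolding alg_indep_def
proof (intro ballI impI allI)
  fix c \<alpha> assume c: "c \<in> mpoly_coeffs m" and zero: "\<forall>x. mpoly_eval m c gs x = 0"
  let ?A = "{\<alpha>. c \<alpha> \<noteq> 0}"
  have fin: "finite ?A" and sup: "\<And>\<alpha> i. c \<alpha> \<noteq> 0 \<Longrightarrow> i \<ge> m \<Longrightarrow> \<alpha> i = 0"
    using c by (auto simp: mpoly_coeffs_def)
  \<comment> \<open>\<open>B\<close> exceeds every exponent occurring in \<open>c\<close>, so
    exponent vectors are digit strings in base \<open>B\<close>.\<close>
  define B where "B = Suc (\<Sum>\<alpha>\<in>?A. \<Sum>i<m. \<alpha> i)"
  have B: "\<alpha> i < B" if "c \<alpha> \<noteq> 0" "i < m" for \<alpha> i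
  proof -
    have "\<alpha> i \<le> (\<Sum>i<m. \<alpha> i)" using that by (intro member_le_sum) auto
    also have "\<dots> \<le> (\<Sum>\<alpha>\<in>?A. \<Sum>i<m. \<alpha> i)" using fin that
      by (intro member_le_sum[of \<alpha> ?A "\<lambda>\<alpha>. \<Sum>i<m. \<alpha> i"]) auto
    finally show ?thesis by (simp add: B_def)
  qed
  define e where "e \<alpha> = (\<Sum>i<m. B ^ i * \<alpha> i)" for \<alpha> :: "nat \<Rightarrow> nat"
  have inj: "\<alpha> = \<beta>" if "c \<alpha> \<noteq> 0" "c \<beta> \<noteq> 0" "e \<alpha> = e \<beta>" for \<alpha> \<beta>
  proof
    fix i
    show "\<alpha> i = \<beta> i"
    proof (cases "i < m")
      case True
      then show ?thesis using base_expansion_inj[of m \<alpha> B \<beta> i] B that by (simp add: e_def)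
    next
      case False
      then show ?thesis using sup[OF that(1), of i] sup[OF that(2), of i] by simp
    qed
  qed
  \<comment> \<open>The image of \<open>c\<close> under the substitution; it will vanish at every
    positive \<open>t\<close> and hence be zero.\<close>
  define p where "p = (\<Sum>\<alpha>\<in>?A. Polynomial.monom (c \<alpha>) (e \<alpha>))"
  have root: "poly p t = 0" if t: "t > 0" for t
  proof -
    obtain x where x: "\<forall>i<m. gs i x = t ^ (B ^ i)"
      using assms[of "\<lambda>i. t ^ (B ^ i)"] zero_less_power[OF t] by blast
    have "0 = (\<Sum>\<alpha>\<in>?A. c \<alpha> * (\<Prod>i<m. gs i x ^ \<alpha> i))"
      using zero by (simp add: mpoly_eval_def)
    also have "\<dots> = (\<Sum>\<alpha>\<in>?A. c \<alpha> * t ^ e \<alpha>)"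
      using x by (intro sum.cong refl) (simp add: e_def power_sum power_mult)
    finally show ?thesis by (simp add: p_def poly_sum poly_monom)
  qed
  have "p = 0"
  proof (rule ccontr)
    assume "p \<noteq> 0"
    then have "finite {t. poly p t = 0}" by (rule poly_roots_finite)
    then have "finite {0::real<..<1}" by (rule rev_finite_subset) (use root in auto)
    then show False using infinite_Ioo[of "0::real" 1] by simp
  qed
  show "c \<alpha> = 0"
  proof (rule ccontr)
    assume "c \<alpha> \<noteq> 0"
    \<comment> \<open>Distinct exponent vectors go to distinct powers of \<open>t\<close>, so no
      coefficients cancel.\<close>
    have "coeff p (e \<alpha>) = (\<Sum>\<beta>\<in>?A. if \<beta> = \<alpha> then c \<beta> else 0)"
      unfolding p_def coeff_sum coeff_monom
      using inj \<open>c \<alpha> \<noteq> 0\<close> by (intro sum.cong refl) (auto)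
    then show False using \<open>p = 0\<close> \<open>c \<alpha> \<noteq> 0\<close> fin by simp
  qed
qed

section \<open>Algebraic dependence by a dimension count\<close>

text \<open>Gaussian elimination: equation \<open>b\<close> eliminates a pivot unknown
  \<open>a0\<close>, which leaves one equation and one unknown fewer.\<close>

lemma underdetermined_system:
  fixes M :: "'a \<Rightarrow> 'b \<Rightarrow> real"
  assumes "finite B" "finite A" "card B < card A"
  shows "\<exists>c. (\<exists>a\<in>A. c a \<noteq> 0) \<and> (\<forall>b\<in>B. (\<Sum>a\<in>A. c a * M a b) = 0)"
  using assms
proof (induction B arbitrary: A M rule: finite_induct)
  case empty
  then obtain a where "a \<in> A" by fastforce
  then show ?case by (intro exI[of _ "\<lambda>_. 1"]) auto
next
  case (insert b B)
  show ?case
  proof (cases "\<forall>a\<in>A. M a b = 0")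
    case True
    have "card B < card A" using insert by simp
    then show ?thesis using insert.IH[of A M] insert.prems True by auto
  next
    case False
    then obtain a0 where a0: "a0 \<in> A" "M a0 b \<noteq> 0" by auto
    let ?A = "A - {a0}"
    have "card B < card ?A" using insert.prems insert.hyps a0 by simp
    then obtain c where c: "\<exists>a\<in>?A. c a \<noteq> 0"
      "\<forall>b'\<in>B. (\<Sum>a\<in>?A. c a * (M a b' - M a b / M a0 b * M a0 b')) = 0"
      using insert.IH[of ?A "\<lambda>a b'. M a b' - M a b / M a0 b * M a0 b'"] insert.prems(1) by auto
    define c0 where "c0 = - (\<Sum>a\<in>?A. c a * M a b) / M a0 b"
    let ?c = "c(a0 := c0)"
    have split: "(\<Sum>a\<in>A. ?c a * M a b') = c0 * M a0 b' + (\<Sum>a\<in>?A. c a * M a b')" for b'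
      using insert.prems a0 by (subst sum.remove[of _ a0]) (auto intro!: sum.cong)
    have "(\<Sum>a\<in>A. ?c a * M a b') = 0" if "b' \<in> B" for b'
    proof -
      have "0 = (\<Sum>a\<in>?A. c a * M a b' - c a * M a b * (M a0 b' / M a0 b))"
        using c(2) that by (simp add: algebra_simps)
      also have "\<dots> = (\<Sum>a\<in>?A. c a * M a b') - (\<Sum>a\<in>?A. c a * M a b) * (M a0 b' / M a0 b)"
        unfolding sum_subtractf sum_distrib_right ..
      finally show ?thesis unfolding split by (simp add: c0_def)
    qed
    moreover have "(\<Sum>a\<in>A. ?c a * M a b) = 0"
      unfolding split using a0 by (simp add: c0_def)
    ultimately show ?thesis using c(1) by (intro exI[of _ ?c]) auto
  qed
qed

text \<open>Bounding the degree in each variable separately makes the number of exponent vectors a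
  pure power.\<close>

definition expvecs :: "nat \<Rightarrow> nat \<Rightarrow> (nat \<Rightarrow> nat) set" where
  "expvecs m D = {\<alpha>. (\<forall>i<m. \<alpha> i \<le> D) \<and> (\<forall>i\<ge>m. \<alpha> i = 0)}"

lemma expvecs_Suc: "expvecs (Suc m) D = (\<lambda>(\<alpha>, k). \<alpha>(m := k)) ` (expvecs m D \<times> {..D})"
proof (intro equalityI subsetI)
  fix \<alpha> assume "\<alpha> \<in> expvecs (Suc m) D"
  then have "(\<alpha>(m := 0), \<alpha> m) \<in> expvecs m D \<times> {..D}"
    by (auto simp: expvecs_def less_Suc_eq Suc_le_eq)
  then show "\<alpha> \<in> (\<lambda>(\<alpha>, k). \<alpha>(m := k)) ` (expvecs m D \<times> {..D})"
    by (rule rev_image_eqI) auto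
qed (auto simp: expvecs_def less_Suc_eq)

lemma finite_card_expvecs: "finite (expvecs m D) \<and> card (expvecs m D) = Suc D ^ m"
proof (induction m)
  case 0
  have "expvecs 0 D = {\<lambda>_. 0}" by (auto simp: expvecs_def)
  then show ?case by simp
next
  case (Suc m)
  have "inj_on (\<lambda>(\<alpha>, k). \<alpha>(m := k)) (expvecs m D \<times> {..D})"
  proof (rule inj_onI; clarify)
    fix \<alpha> \<beta> k l assume ab: "\<alpha> \<in> expvecs m D" "\<beta> \<in> expvecs m D" and eq: "\<alpha>(m := k) = \<beta>(m := l)"
    have "\<alpha> i = \<beta> i" for i
      using fun_cong[OF eq, of i] ab by (cases "i = m") (auto simp: expvecs_def)
    then show "\<alpha> = \<beta> \<and> k = l" using fun_cong[OF eq, of m] by auto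
  qed
  then show ?case using Suc by (simp add: expvecs_Suc card_image card_cartesian_product)
qed

lemmas finite_expvecs = finite_card_expvecs[THEN conjunct1]
lemmas card_expvecs = finite_card_expvecs[THEN conjunct2]

definition poly_le :: "nat \<Rightarrow> nat \<Rightarrow> ((nat \<Rightarrow> real) \<Rightarrow> real) \<Rightarrow> bool" where
  "poly_le N K P \<longleftrightarrow> (\<exists>p. P = (\<lambda>y. \<Sum>\<beta>\<in>expvecs N K. p \<beta> * (\<Prod>i<N. y i ^ \<beta> i)))"

lemma poly_le_monom:
  assumes "\<beta> \<in> expvecs N K"
  shows "poly_le N K (\<lambda>y. c * (\<Prod>i<N. y i ^ \<beta> i))"
  unfolding poly_le_def
proof (intro exI ext)
  fix y :: "nat \<Rightarrow> real"
  have "(\<Sum>\<gamma>\<in>expvecs N K. (if \<gamma> = \<beta> then c else 0) * (\<Prod>i<N. y i ^ \<gamma> i)) =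
        (\<Sum>\<gamma>\<in>expvecs N K. if \<gamma> = \<beta> then c * (\<Prod>i<N. y i ^ \<beta> i) else 0)"
    by (intro sum.cong) auto
  then show "c * (\<Prod>i<N. y i ^ \<beta> i) =
      (\<Sum>\<gamma>\<in>expvecs N K. (if \<gamma> = \<beta> then c else 0) * (\<Prod>i<N. y i ^ \<gamma> i))"
    using assms finite_expvecs by simp
qed

lemma poly_le_add:
  assumes "poly_le N K P" "poly_le N K Q"
  shows "poly_le N K (\<lambda>y. P y + Q y)"
proof -
  obtain p q where "P = (\<lambda>y. \<Sum>\<beta>\<in>expvecs N K. p \<beta> * (\<Prod>i<N. y i ^ \<beta> i))"
    "Q = (\<lambda>y. \<Sum>\<beta>\<in>expvecs N K. q \<beta> * (\<Prod>i<N. y i ^ \<beta> i))"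
    using assms by (auto simp: poly_le_def)
  then show ?thesis unfolding poly_le_def
    by (intro exI[of _ "\<lambda>\<beta>. p \<beta> + q \<beta>"]) (simp add: distrib_right sum.distrib)
qed

lemma poly_le_sum:
  assumes "\<And>i. i \<in> I \<Longrightarrow> poly_le N K (P i)"
  shows "poly_le N K (\<lambda>y. \<Sum>i\<in>I. P i y)"
proof -
  have "poly_le N K (\<lambda>y. 0)"
    unfolding poly_le_def by (intro exI[of _ "\<lambda>_. 0"]) simp
  then show ?thesis using assms
    by (induction I rule: infinite_finite_induct) (auto intro: poly_le_add)
qed

lemma poly_le_mult:
  assumes "poly_le N K P" "poly_le N L Q"
  shows "poly_le N (K + L) (\<lambda>y. P y * Q y)"
proof -
  obtain p q where P: "P = (\<lambda>y. \<Sum>\<beta>\<in>expvecs N K. p \<beta> * (\<Prod>i<N. y i ^ \<beta> i))"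
    and Q: "Q = (\<lambda>y. \<Sum>\<beta>\<in>expvecs N L. q \<beta> * (\<Prod>i<N. y i ^ \<beta> i))"
    using assms by (auto simp: poly_le_def)
  have "(\<lambda>y. P y * Q y) = (\<lambda>y. \<Sum>\<beta>\<in>expvecs N K. \<Sum>\<gamma>\<in>expvecs N L.
      p \<beta> * q \<gamma> * (\<Prod>i<N. y i ^ (\<beta> i + \<gamma> i)))"
    unfolding P Q by (simp add: sum_product power_add prod.distrib mult_ac)
  moreover have "poly_le N (K + L) (\<lambda>y. \<Sum>\<beta>\<in>expvecs N K. \<Sum>\<gamma>\<in>expvecs N L.
      p \<beta> * q \<gamma> * (\<Prod>i<N. y i ^ (\<beta> i + \<gamma> i)))"
    by (intro poly_le_sum poly_le_monom) (auto simp: expvecs_def intro: add_mono)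
  ultimately show ?thesis by simp
qed

lemma poly_le_mono:
  assumes "poly_le N K P" "K \<le> L"
  shows "poly_le N L P"
proof -
  obtain p where P: "P = (\<lambda>y. \<Sum>\<beta>\<in>expvecs N K. p \<beta> * (\<Prod>i<N. y i ^ \<beta> i))"
    using assms by (auto simp: poly_le_def)
  show ?thesis unfolding P
    using assms(2) by (intro poly_le_sum poly_le_monom) (auto simp: expvecs_def intro: order_trans)
qed

lemma poly_le_const: "poly_le N K (\<lambda>y. c)"
  using poly_le_monom[of "\<lambda>_. 0" N K c] by (simp add: expvecs_def)

lemma poly_le_coord:
  assumes "i < N"
  shows "poly_le N 1 (\<lambda>y. y i)"
proof -
  have "(\<Prod>j<N. y j ^ (if j = i then 1 else 0)) = y i" for y :: "nat \<Rightarrow> real"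
  proof -
    have "(\<Prod>j<N. y j ^ (if j = i then 1 else 0)) = (\<Prod>j<N. if j = i then y j else 1)"
      by (intro prod.cong) auto
    then show ?thesis using assms by simp
  qed
  then show ?thesis
    using poly_le_monom[of "\<lambda>j. if j = i then 1 else 0" N 1 1] assms by (simp add: expvecs_def)
qed

lemma poly_le_power: "poly_le N K P \<Longrightarrow> poly_le N (a * K) (\<lambda>y. P y ^ a)"
  by (induction a) (auto intro: poly_le_const poly_le_mult)

lemma poly_le_prod:
  assumes "\<And>i. i < m \<Longrightarrow> poly_le N K (P i)"
  shows "poly_le N (m * K) (\<lambda>y. \<Prod>i<m. P i y)"
  using assms
proof (induction m)
  case (Suc m)
  then have "poly_le N (m * K + K) (\<lambda>y. (\<Prod>i<m. P i y) * P m y)"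
    by (intro poly_le_mult) auto
  then show ?case by (simp add: add.commute)
qed (auto intro: poly_le_const)

lemma fun_algebra_poly_le: "fun_algebra {P. \<exists>K. poly_le N K P}"
proof
  fix f g assume "f \<in> {P. \<exists>K. poly_le N K P}" "g \<in> {P. \<exists>K. poly_le N K P}"
  then obtain K L where "poly_le N K f" "poly_le N L g" by auto
  then show "(\<lambda>x. f x + g x) \<in> {P. \<exists>K. poly_le N K P}"
    using poly_le_add[OF poly_le_mono[of N K f "max K L"] poly_le_mono[of N L g "max K L"]] by auto
qed (auto intro: poly_le_const poly_le_mult)

text \<open>Counting: the \<open>(D + 1) ^ m\<close> power products of degree at most \<open>D\<close> in each factor lie in
  a space of dimension \<open>(m D K + 1) ^ N\<close>, which is smaller for large \<open>D\<close>.\<close>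

lemma algebraic_dependence:
  assumes "N < m" and P: "\<And>i. i < m \<Longrightarrow> \<exists>K. poly_le N K (P i)"
  shows "\<exists>c\<in>mpoly_coeffs m. (\<exists>\<alpha>. c \<alpha> \<noteq> 0) \<and> (\<forall>y. mpoly_eval m c P y = 0)"
proof -
  obtain k where k: "\<And>i. i < m \<Longrightarrow> poly_le N (k i) (P i)" using P by metis
  define K where "K = Suc (\<Sum>i<m. k i)"
  have K: "poly_le N K (P i)" if "i < m" for i
    using k[OF that] poly_le_mono member_le_sum[of i "{..<m}" k] that by (fastforce simp: K_def)
  \<comment> \<open>This choice gives \<open>Suc (m * (D * K)) ^ N \<le> D * Suc D ^ N\<close>,
    which is below \<open>Suc D ^ m\<close> because \<open>N < m\<close>.\<close>
  define D where "D = (m * K) ^ N"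
  have deg: "poly_le N (m * (D * K)) (\<lambda>y. \<Prod>i<m. P i y ^ \<alpha> i)" if "\<alpha> \<in> expvecs m D" for \<alpha>
  proof (rule poly_le_prod)
    fix i assume "i < m"
    then show "poly_le N (D * K) (\<lambda>y. P i y ^ \<alpha> i)"
      using poly_le_power[OF K, of i "\<alpha> i"] that poly_le_mono by (fastforce simp: expvecs_def)
  qed
  then have "\<forall>\<alpha>\<in>expvecs m D. \<exists>p. (\<lambda>y. \<Prod>i<m. P i y ^ \<alpha> i) =
      (\<lambda>y. \<Sum>\<beta>\<in>expvecs N (m * (D * K)). p \<beta> * (\<Prod>i<N. y i ^ \<beta> i))"
    unfolding poly_le_def by blast
  from bchoice[OF this] obtain M where M: "\<forall>\<alpha>\<in>expvecs m D. (\<lambda>y. \<Prod>i<m. P i y ^ \<alpha> i) =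
      (\<lambda>y. \<Sum>\<beta>\<in>expvecs N (m * (D * K)). M \<alpha> \<beta> * (\<Prod>i<N. y i ^ \<beta> i))" ..
  have "card (expvecs N (m * (D * K))) < card (expvecs m D)"
  proof -
    have "1 \<le> m * K" using assms(1) by (simp add: K_def)
    moreover have "m * K * Suc D = m * K + m * (D * K)" by (simp add: algebra_simps)
    ultimately have "Suc (m * (D * K)) \<le> m * K * Suc D" by linarith
    then have "Suc (m * (D * K)) ^ N \<le> (m * K * Suc D) ^ N" by (rule power_mono) simp
    also have "\<dots> = D * Suc D ^ N" unfolding D_def by (rule power_mult_distrib)
    also have "\<dots> < Suc D * Suc D ^ N" by simp
    also have "\<dots> \<le> Suc D ^ m" using assms(1) power_increasing[of "Suc N" m "Suc D"] by simp
    finally show ?thesis by (simp add: card_expvecs)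
  qed
  \<comment> \<open>A linear relation between the coefficient rows \<open>M \<alpha>\<close>; there
    are more rows than columns.\<close>
  then obtain c where c: "\<exists>\<alpha>\<in>expvecs m D. c \<alpha> \<noteq> 0"
    "\<forall>\<beta>\<in>expvecs N (m * (D * K)). (\<Sum>\<alpha>\<in>expvecs m D. c \<alpha> * M \<alpha> \<beta>) = 0"
    using underdetermined_system[OF finite_expvecs finite_expvecs, of N _ m D M] by blast
  define c' where "c' \<alpha> = (if \<alpha> \<in> expvecs m D then c \<alpha> else 0)" for \<alpha>
  have "finite {\<alpha>. c' \<alpha> \<noteq> 0}"
    by (rule finite_subset[OF _ finite_expvecs[of m D]]) (auto simp: c'_def)
  then have "c' \<in> mpoly_coeffs m"
    unfolding mpoly_coeffs_def by (auto simp: c'_def expvecs_def split: if_splits)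
  moreover have "\<exists>\<alpha>. c' \<alpha> \<noteq> 0" using c(1) by (auto simp: c'_def)
  moreover have "mpoly_eval m c' P y = 0" for y
  proof -
    have "mpoly_eval m c' P y = (\<Sum>\<alpha>\<in>expvecs m D. c \<alpha> * (\<Prod>i<m. P i y ^ \<alpha> i))"
      unfolding mpoly_eval_def
      by (rule sum.mono_neutral_cong_left) (auto simp: c'_def finite_expvecs split: if_splits)
    also have "\<dots> = (\<Sum>\<alpha>\<in>expvecs m D. c \<alpha> * (\<Sum>\<beta>\<in>expvecs N (m * (D * K)). M \<alpha> \<beta> * (\<Prod>i<N. y i ^ \<beta> i)))"
      using fun_cong[OF bspec[OF M], of _ y] by simp
    also have "\<dots> = (\<Sum>\<beta>\<in>expvecs N (m * (D * K)). (\<Sum>\<alpha>\<in>expvecs m D. c \<alpha> * M \<alpha> \<beta>) * (\<Prod>i<N. y i ^ \<beta> i))"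
      by (simp add: sum_distrib_left sum_distrib_right mult_ac sum.swap[of _ "expvecs m D"])
    finally show ?thesis using c(2) by simp
  qed
  ultimately show ?thesis by blast
qed

section \<open>Commutativity\<close>

definition krow :: "'n::finite aff \<Rightarrow> nat \<Rightarrow> real^'n" where
  "krow x i = snd x v* mpow (fst x) i"

lemma krow_0: "krow x 0 = snd x"
  by (simp add: krow_def)

lemma krow_Suc: "krow x (Suc i) = krow x i v* fst x"
  by (simp add: krow_def vector_matrix_mul_assoc)

lemma krow_Suc_inner: "krow x (Suc i) \<bullet> \<xi> = krow x i \<bullet> (fst x *v \<xi>)"
  by (simp add: krow_Suc dot_lmul_matrix)

lemma f_poly_krow: "f_poly k xi x = det_k k (\<lambda>i j. krow x i \<bullet> xi j)"
  by (simp add: f_poly_def krow_def dot_lmul_matrix)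

definition outer :: "real^'n \<Rightarrow> real^'n \<Rightarrow> real^'n^'n" where
  "outer \<xi> b = (\<chi> p q. \<xi> $ p * b $ q)"

lemma outer_mult_vec: "outer \<xi> b *v \<eta> = (b \<bullet> \<eta>) *\<^sub>R \<xi>"
  by (simp add: outer_def matrix_vector_mult_def Finite_Cartesian_Product.vec_eq_iff inner_vec_def sum_distrib_left
      mult_ac)

lemma outer_mult_outer: "outer \<xi> b ** outer \<eta> c = (b \<bullet> \<eta>) *\<^sub>R outer \<xi> c"
  by (simp add: outer_def matrix_matrix_mult_def Finite_Cartesian_Product.vec_eq_iff inner_vec_def sum_distrib_left
      mult_ac)

text \<open>Transposing the matrix part turns the pairing into the inner product, which gives
  linearity and nondegeneracy.\<close>

lemma aff_pair_inner: "aff_pair x X = (transpose (fst x), snd x) \<bullet> X"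
  unfolding aff_pair_def inner_prod_def
  by (simp add: inner_vec_def transpose_def sum.swap[of "\<lambda>i j. fst x $ i $ j * fst X $ j $ i"])

lemma aff_pair_outer: "aff_pair x (outer \<xi> b, \<eta>) = b \<bullet> (fst x *v \<xi>) + snd x \<bullet> \<eta>"
  by (simp add: aff_pair_def outer_def inner_vec_def matrix_vector_mult_def sum_distrib_left mult_ac)

lemma aff_pair_eq_0:
  assumes "\<And>y. aff_pair y D = 0"
  shows "D = 0"
proof -
  have "aff_pair (transpose (fst D), snd D) D = D \<bullet> D"
    by (simp add: aff_pair_inner)
  then show ?thesis using assms by simp
qed

section \<open>The form Phi_x (\<open>lp_form\<close>) on differentials of Krylov entries\<close>

definition lp_form :: "'n::finite aff \<Rightarrow> 'n aff \<Rightarrow> 'n aff \<Rightarrow> real" where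
  "lp_form x X Y = aff_pair x (aff_bracket X Y)"

lemma matrix_add_rdistrib': "(A + B) ** C = A ** C + B ** (C :: real^'n^'n)"
  by (simp add: matrix_matrix_mult_def Finite_Cartesian_Product.vec_eq_iff distrib_right sum.distrib)

lemma linear_lp_form_left: "linear (\<lambda>X. lp_form x X Y)"
proof
  fix X X' :: "'a aff" and c :: real
  have "aff_bracket (X + X') Y = aff_bracket X Y + aff_bracket X' Y"
    by (simp add: aff_bracket_def matrix_add_ldistrib matrix_add_rdistrib'
        matrix_vector_mult_add_rdistrib matrix_vector_right_distrib)
  then show "lp_form x (X + X') Y = lp_form x X Y + lp_form x X' Y"
    by (simp add: lp_form_def aff_pair_inner inner_add_right)
  have "aff_bracket (c *\<^sub>R X) Y = c *\<^sub>R aff_bracket X Y"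
    by (simp add: aff_bracket_def matrix_matrix_mult_def matrix_vector_mult_def Finite_Cartesian_Product.vec_eq_iff
        sum_distrib_left mult_ac right_diff_distrib)
  then show "lp_form x (c *\<^sub>R X) Y = c *\<^sub>R lp_form x X Y"
    by (simp add: lp_form_def aff_pair_inner)
qed

lemma lp_form_antisym: "lp_form x X Y = - lp_form x Y X"
proof -
  have "aff_bracket X Y = - aff_bracket Y X" by (simp add: aff_bracket_def)
  then show ?thesis by (simp add: lp_form_def aff_pair_inner inner_minus_right)
qed

lemma linear_lp_form_right: "linear (\<lambda>Y. lp_form x X Y)"
proof -
  have "(\<lambda>Y. lp_form x X Y) = (\<lambda>Y. - lp_form x Y X)" using lp_form_antisym by blast
  then show ?thesis using linear_compose_neg[OF linear_lp_form_left] by simp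
qed

lemma lp_form_add_left: "lp_form x (X + X') Y = lp_form x X Y + lp_form x X' Y"
  by (rule linear_add[OF linear_lp_form_left])

lemma lp_form_add_right: "lp_form x X (Y + Y') = lp_form x X Y + lp_form x X Y'"
  by (rule linear_add[OF linear_lp_form_right])

lemma lp_form_outer_outer:
  "lp_form x (outer \<xi> b, 0) (outer \<eta> c, 0) =
     (b \<bullet> \<eta>) * (c \<bullet> (fst x *v \<xi>)) - (c \<bullet> \<xi>) * (b \<bullet> (fst x *v \<eta>))"
proof -
  have "aff_bracket (outer \<xi> b, 0) (outer \<eta> c, 0) =
      (b \<bullet> \<eta>) *\<^sub>R (outer \<xi> c, 0) - (c \<bullet> \<xi>) *\<^sub>R (outer \<eta> b, 0)"
    by (simp add: aff_bracket_def outer_mult_outer)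
  then have "lp_form x (outer \<xi> b, 0) (outer \<eta> c, 0) =
      (b \<bullet> \<eta>) * aff_pair x (outer \<xi> c, 0) - (c \<bullet> \<xi>) * aff_pair x (outer \<eta> b, 0)"
    by (simp only: lp_form_def aff_pair_inner inner_diff_right inner_scaleR_right)
  then show ?thesis by (simp add: aff_pair_outer)
qed

lemma lp_form_outer_vec: "lp_form x (outer \<xi> b, 0) (0, \<eta>) = (snd x \<bullet> \<xi>) * (b \<bullet> \<eta>)"
  by (simp add: lp_form_def aff_bracket_def aff_pair_inner inner_prod_def outer_mult_vec)

lemma lp_form_vec_vec: "lp_form x (0, \<xi>) (0, \<eta>) = 0"
  by (simp add: lp_form_def aff_bracket_def aff_pair_inner inner_prod_def)

text \<open>The differential of \<open>x \<mapsto> krow x i \<bullet> \<xi>\<close>.\<close>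

primrec kdiff :: "'n::finite aff \<Rightarrow> nat \<Rightarrow> real^'n \<Rightarrow> 'n aff" where
  "kdiff x 0 \<xi> = (0, \<xi>)"
| "kdiff x (Suc i) \<xi> = kdiff x i (fst x *v \<xi>) + (outer \<xi> (krow x i), 0)"

text \<open>In the induction, the hypothesis at \<open>fst x *v \<eta>\<close> contributes a product
  that cancels the negative term of \<open>lp_form_outer_outer\<close>.\<close>

lemma lp_form_outer_kdiff:
  "lp_form x (outer \<xi> b, 0) (kdiff x j \<eta>) = (b \<bullet> \<eta>) * (krow x j \<bullet> \<xi>)"
proof (induction j arbitrary: \<eta>)
  case 0
  then show ?case by (simp add: lp_form_outer_vec krow_0)
next
  case (Suc j)
  then show ?case
    by (simp add: lp_form_add_right lp_form_outer_outer krow_Suc_inner)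
qed

text \<open>The case \<open>i = 0\<close> of the general formula. Moving \<open>fst x\<close> from
  \<open>\<eta>\<close> to the row raises the second index, and the new rank-one part supplies the
  term \<open>u = j\<close>.\<close>

lemma lp_form_vec_kdiff:
  "lp_form x (0, \<xi>) (kdiff x j \<eta>) =
    - (\<Sum>u<j. (krow x u \<bullet> \<xi>) * (krow x (j - 1 - u) \<bullet> \<eta>))"
proof (induction j arbitrary: \<eta>)
  case 0
  then show ?case by (simp add: lp_form_vec_vec)
next
  case (Suc j)
  have "(\<Sum>u<j. (krow x u \<bullet> \<xi>) * (krow x (j - 1 - u) \<bullet> (fst x *v \<eta>))) =
        (\<Sum>u<j. (krow x u \<bullet> \<xi>) * (krow x (j - u) \<bullet> \<eta>))"
    by (intro sum.cong refl) (simp flip: krow_Suc_inner add: Suc_diff_Suc)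
  moreover have "lp_form x (0, \<xi>) (outer \<eta> (krow x j), 0) = - ((krow x j \<bullet> \<xi>) * (krow x 0 \<bullet> \<eta>))"
    by (subst lp_form_antisym) (simp add: lp_form_outer_vec krow_0)
  ultimately show ?case by (simp add: lp_form_add_right Suc)
qed

text \<open>The sums telescope when \<open>i\<close> increases; this is why the bracket of two entries of the
  matrices defining \<open>f_poly\<close> only involves rows of index between \<open>i\<close> and \<open>j\<close>.\<close>

lemma lp_form_kdiff_kdiff:
  "lp_form x (kdiff x i \<xi>) (kdiff x j \<eta>) =
     (\<Sum>u<i. (krow x u \<bullet> \<xi>) * (krow x (i + j - 1 - u) \<bullet> \<eta>)) -
     (\<Sum>u<j. (krow x u \<bullet> \<xi>) * (krow x (i + j - 1 - u) \<bullet> \<eta>))"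
proof (induction i arbitrary: \<xi>)
  case 0
  then show ?case by (simp add: lp_form_vec_kdiff)
next
  case (Suc i)
  \<comment> \<open>Replacing \<open>\<xi>\<close> by \<open>fst x *v \<xi>\<close> shifts both sums
    to \<open>g (Suc u)\<close>; the two terms \<open>g 0\<close> cancel, and the rank-one part
    contributes \<open>g j\<close>.\<close>
  define g where "g u = (krow x u \<bullet> \<xi>) * (krow x (i + j - u) \<bullet> \<eta>)" for u
  have "lp_form x (kdiff x (Suc i) \<xi>) (kdiff x j \<eta>) =
      (\<Sum>u<i. g (Suc u)) - (\<Sum>u<j. g (Suc u)) + g j"
    by (simp add: lp_form_add_left lp_form_outer_kdiff Suc g_def krow_Suc_inner mult.commute)
  also have "\<dots> = (\<Sum>u<Suc i. g u) - (\<Sum>u<j. g u)"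
    using sum.lessThan_Suc_shift[of g i] sum.lessThan_Suc_shift[of g j] by simp
  finally show ?case by (simp add: g_def)
qed

section \<open>Gradients of the \<open>f_poly\<close> and their brackets\<close>

primrec krow_deriv :: "'n::finite aff \<Rightarrow> nat \<Rightarrow> 'n aff \<Rightarrow> real^'n" where
  "krow_deriv x 0 y = snd y"
| "krow_deriv x (Suc i) y = krow x i v* fst y + krow_deriv x i y v* fst x"

lemma bounded_bilinear_vector_matrix_mult:
  "bounded_bilinear (\<lambda>(v :: real^'n) (M :: real^'n^'n). v v* M)"
proof -
  have "bilinear (\<lambda>(v :: real^'n) (M :: real^'n^'n). v v* M)"
    unfolding bilinear_def
    by (auto intro!: linearI simp: vector_matrix_mult_def Finite_Cartesian_Product.vec_eq_iff distrib_left distrib_right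
        sum.distrib sum_distrib_left mult_ac)
  then show ?thesis by (simp add: bilinear_conv_bounded_bilinear)
qed

lemma has_derivative_krow: "((\<lambda>x. krow x i) has_derivative krow_deriv x i) (at x)"
proof (induction i)
  case 0
  show ?case by (simp add: krow_0 has_derivative_snd)
next
  case (Suc i)
  show ?case unfolding krow_Suc krow_deriv.simps
    by (intro bounded_bilinear.FDERIV[OF bounded_bilinear_vector_matrix_mult Suc]
        has_derivative_fst has_derivative_ident)
qed

text \<open>Both recursions are the product rule for \<open>krow x i v* fst x\<close>; the rank-one
  part of \<open>kdiff\<close> represents the variation of the last factor.\<close>

lemma krow_deriv_inner: "krow_deriv x i y \<bullet> \<xi> = aff_pair y (kdiff x i \<xi>)"
proof (induction i arbitrary: \<xi>)
  case 0
  show ?case by (simp add: aff_pair_inner inner_prod_def)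
next
  case (Suc i)
  have "aff_pair y (kdiff x (Suc i) \<xi>) =
    aff_pair y (kdiff x i (fst x *v \<xi>)) + aff_pair y (outer \<xi> (krow x i), 0)"
    by (simp add: aff_pair_inner inner_add_right del: inner_Pair)
  then show ?case
    by (simp add: inner_add_left dot_lmul_matrix Suc aff_pair_outer)
qed

definition f_grad :: "nat \<Rightarrow> (nat \<Rightarrow> real^'n) \<Rightarrow> 'n::finite aff \<Rightarrow> 'n aff" where
  "f_grad k xi x = (\<Sum>i<k. \<Sum>q<k. cof_k k (\<lambda>i j. krow x i \<bullet> xi j) i q *\<^sub>R kdiff x i (xi q))"

lemma has_derivative_f_poly:
  "(f_poly k xi has_derivative (\<lambda>y. aff_pair y (f_grad k xi x))) (at x)"
proof -
  have "((\<lambda>x. det_k k (\<lambda>i j. krow x i \<bullet> xi j)) has_derivative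
    (\<lambda>y. \<Sum>i<k. \<Sum>q<k. cof_k k (\<lambda>i j. krow x i \<bullet> xi j) i q * (krow_deriv x i y \<bullet> xi q))) (at x)"
    by (intro has_derivative_det_k has_derivative_inner_left has_derivative_krow)
  then show ?thesis
    unfolding f_poly_krow[abs_def] f_grad_def krow_deriv_inner
    by (simp add: aff_pair_inner inner_sum_right)
qed

text \<open>Bilinearity splits the bracket over pairs of rows \<open>i\<close>, \<open>j\<close>;
  once contracted with the cofactors, each pair contributes zero separately.\<close>

lemma lp_form_f_grad: "lp_form x (f_grad l xi x) (f_grad k xi' x) = 0"
proof -
  let ?C = "cof_k l (\<lambda>i j. krow x i \<bullet> xi j)" and ?C' = "cof_k k (\<lambda>i j. krow x i \<bullet> xi' j)"
  \<comment> \<open>By expansion along row \<open>i\<close>, \<open>X i u\<close> is the first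
    determinant with that row replaced by the entries of \<open>krow x u\<close>, so a row repeats
    when \<open>u < i\<close>. \<open>Y\<close> is the analogue for the second determinant.\<close>
  define X where "X i u = (\<Sum>q<l. ?C i q * (krow x u \<bullet> xi q))" for i u
  define Y where "Y j w = (\<Sum>r<k. ?C' j r * (krow x w \<bullet> xi' r))" for j w
  have X: "X i u = 0" if "i < l" "u < i" for i u
    using sum_cof_k_row[of i l u "\<lambda>i j. krow x i \<bullet> xi j"] that by (simp add: X_def)
  have Y: "Y j w = 0" if "j < k" "w < j" for j w
    using sum_cof_k_row[of j k w "\<lambda>i j. krow x i \<bullet> xi' j"] that by (simp add: Y_def)
  have prod: "(\<Sum>q<l. \<Sum>r<k. ?C i q * (?C' j r * ((krow x u \<bullet> xi q) * (krow x w \<bullet> xi' r)))) = X i u * Y j w"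
    for i j u w
    unfolding X_def Y_def by (simp add: sum_product mult_ac)
  have zero: "(\<Sum>q<l. \<Sum>r<k. ?C i q * (?C' j r * lp_form x (kdiff x i (xi q)) (kdiff x j (xi' r)))) = 0"
    if "i < l" "j < k" for i j
  proof -
    have swap: "(\<Sum>q<l. \<Sum>r<k. ?C i q * (?C' j r * (\<Sum>u<m. (krow x u \<bullet> xi q) * (krow x (w u) \<bullet> xi' r))))
        = (\<Sum>u<m. X i u * Y j (w u))" for m w
    proof -
      have "(\<Sum>q<l. \<Sum>r<k. ?C i q * (?C' j r * (\<Sum>u<m. (krow x u \<bullet> xi q) * (krow x (w u) \<bullet> xi' r))))
        = (\<Sum>q<l. \<Sum>u<m. \<Sum>r<k. ?C i q * (?C' j r * ((krow x u \<bullet> xi q) * (krow x (w u) \<bullet> xi' r))))"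
        unfolding sum_distrib_left by (intro sum.cong[OF refl] sum.swap)
      also have "\<dots> = (\<Sum>u<m. \<Sum>q<l. \<Sum>r<k. ?C i q * (?C' j r * ((krow x u \<bullet> xi q) * (krow x (w u) \<bullet> xi' r))))"
        by (rule sum.swap)
      finally show ?thesis unfolding prod .
    qed
    have "(\<Sum>q<l. \<Sum>r<k. ?C i q * (?C' j r * lp_form x (kdiff x i (xi q)) (kdiff x j (xi' r)))) =
      (\<Sum>u<i. X i u * Y j (i + j - 1 - u)) - (\<Sum>u<j. X i u * Y j (i + j - 1 - u))"
      unfolding lp_form_kdiff_kdiff right_diff_distrib sum_subtractf swap ..
    moreover have "(\<Sum>u<i. X i u * Y j (i + j - 1 - u)) = 0"
      using X[OF \<open>i < l\<close>] by simp
    \<comment> \<open>For \<open>u < i\<close> the first factor vanishes; for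
      \<open>i \<le> u < j\<close> the index \<open>i + j - 1 - u\<close> is below \<open>j\<close>,
      so the second one does.\<close>
    moreover have "X i u * Y j (i + j - 1 - u) = 0" if "u < j" for u
      using X[OF \<open>i < l\<close>, of u] Y[OF \<open>j < k\<close>, of "i + j - 1 - u"] that by (cases "u < i") auto
    then have "(\<Sum>u<j. X i u * Y j (i + j - 1 - u)) = 0" by (intro sum.neutral) simp
    ultimately show ?thesis by simp
  qed
  have left: "lp_form x (f_grad l xi x) Z = (\<Sum>i<l. \<Sum>q<l. ?C i q * lp_form x (kdiff x i (xi q)) Z)" for Z
    by (simp add: f_grad_def linear_sum[OF linear_lp_form_left] linear_scale[OF linear_lp_form_left])
  have right: "lp_form x Z (f_grad k xi' x) = (\<Sum>j<k. \<Sum>r<k. ?C' j r * lp_form x Z (kdiff x j (xi' r)))" for Z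
    by (simp add: f_grad_def linear_sum[OF linear_lp_form_right] linear_scale[OF linear_lp_form_right])
  have "lp_form x (f_grad l xi x) (f_grad k xi' x) =
    (\<Sum>i<l. \<Sum>q<l. \<Sum>j<k. \<Sum>r<k. ?C i q * (?C' j r * lp_form x (kdiff x i (xi q)) (kdiff x j (xi' r))))"
    unfolding left unfolding right by (simp add: sum_distrib_left)
  also have "\<dots> = (\<Sum>i<l. \<Sum>j<k. \<Sum>q<l. \<Sum>r<k.
      ?C i q * (?C' j r * lp_form x (kdiff x i (xi q)) (kdiff x j (xi' r))))"
    by (intro sum.cong[OF refl] sum.swap)
  also have "\<dots> = 0" using zero by simp
  finally show ?thesis .
qed

section \<open>From the generators to the generated algebra\<close>

text \<open>Uniqueness of derivatives and nondegeneracy of the pairing resolve the choice in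
  \<open>aff_diff\<close>.\<close>

lemma aff_diff_eqI:
  assumes "(f has_derivative (\<lambda>y. aff_pair y D)) (at x)"
  shows "aff_diff f x = D"
  unfolding aff_diff_def
proof (rule some_equality)
  fix E assume "(f has_derivative (\<lambda>y. aff_pair y E)) (at x)"
  then have "(\<lambda>y. aff_pair y E) = (\<lambda>y. aff_pair y D)"
    by (rule has_derivative_unique[OF _ assms])
  then have "aff_pair y (E - D) = 0" for y
    unfolding aff_pair_inner inner_diff_right by (metis (lifting) aff_pair_inner diff_self)
  then show "E = D" using aff_pair_eq_0[of "E - D"] by simp
qed (rule assms)

lemma lp_bracket_f_poly: "lp_bracket (f_poly l xi) (f_poly k xi') x = 0"
  using lp_form_f_grad
  by (simp add: lp_bracket_def aff_diff_eqI[OF has_derivative_f_poly] lp_form_def)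

text \<open>Differentiability of \<open>f\<close> is built in, so that sums and products inherit the
  condition and \<open>aff_diff f x\<close> is meaningful.\<close>

definition commuting :: "('n::finite aff \<Rightarrow> real) \<Rightarrow> ('n aff \<Rightarrow> real) set" where
  "commuting g = {f. \<forall>x. \<exists>D. (f has_derivative (\<lambda>y. aff_pair y D)) (at x) \<and>
     lp_form x D (aff_diff g x) = 0}"

lemma lp_bracket_commuting:
  assumes "f \<in> commuting g"
  shows "lp_bracket f g x = 0"
proof -
  obtain D where "(f has_derivative (\<lambda>y. aff_pair y D)) (at x)" "lp_form x D (aff_diff g x) = 0"
    using assms unfolding commuting_def by blast
  then show ?thesis by (simp add: lp_bracket_def lp_form_def aff_diff_eqI)
qed

lemma fun_algebra_commuting: "fun_algebra (commuting g)"
proof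
  fix c
  have "((\<lambda>x. c) has_derivative (\<lambda>y. aff_pair y 0)) (at x)" for x :: "'a aff"
    by (simp add: aff_pair_inner del: zero_prod_def)
  then show "(\<lambda>x. c) \<in> commuting g"
    unfolding commuting_def using linear_0[OF linear_lp_form_left] by blast
next
  fix f1 f2 assume f: "f1 \<in> commuting g" "f2 \<in> commuting g"
  { fix x
    obtain D1 D2 where D: "(f1 has_derivative (\<lambda>y. aff_pair y D1)) (at x)"
        "(f2 has_derivative (\<lambda>y. aff_pair y D2)) (at x)"
        "lp_form x D1 (aff_diff g x) = 0" "lp_form x D2 (aff_diff g x) = 0"
      using f unfolding commuting_def by blast
    have "\<exists>D. ((\<lambda>x. f1 x + f2 x) has_derivative (\<lambda>y. aff_pair y D)) (at x) \<and>
        lp_form x D (aff_diff g x) = 0"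
      using has_derivative_add[OF D(1,2)] D(3,4)
      by (intro exI[of _ "D1 + D2"]) (simp add: aff_pair_inner inner_add_right lp_form_add_left)
    moreover have "\<exists>D. ((\<lambda>x. f1 x * f2 x) has_derivative (\<lambda>y. aff_pair y D)) (at x) \<and>
        lp_form x D (aff_diff g x) = 0"
      using has_derivative_mult[OF D(1,2)] D(3,4)
      by (intro exI[of _ "f1 x *\<^sub>R D2 + f2 x *\<^sub>R D1"])
         (simp add: aff_pair_inner inner_add_right lp_form_add_left mult.commute
           linear_scale[OF linear_lp_form_left])
    moreover note calculation }
  then show "(\<lambda>x. f1 x + f2 x) \<in> commuting g" "(\<lambda>x. f1 x * f2 x) \<in> commuting g"
    unfolding commuting_def by blast+
qed

text \<open>The form is antisymmetric; \<open>g \<in> commuting g\<close> supplies the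
  differentiability of \<open>g\<close>.\<close>

lemma commuting_sym:
  assumes "f \<in> commuting g" and "g \<in> commuting g"
  shows "g \<in> commuting f"
  unfolding commuting_def
proof (intro CollectI allI)
  fix x
  obtain D where D: "(f has_derivative (\<lambda>y. aff_pair y D)) (at x)" "lp_form x D (aff_diff g x) = 0"
    using assms(1) unfolding commuting_def by blast
  obtain E where E: "(g has_derivative (\<lambda>y. aff_pair y E)) (at x)"
    using assms(2) unfolding commuting_def by blast
  have "lp_form x E (aff_diff f x) = 0"
    using D(2) lp_form_antisym[of x E D] by (simp add: aff_diff_eqI[OF D(1)] aff_diff_eqI[OF E])
  with E show "\<exists>D. (g has_derivative (\<lambda>y. aff_pair y D)) (at x) \<and> lp_form x D (aff_diff f x) = 0"
    by blast
qed

text \<open>Two passes: the algebra commutes with each generator, so by symmetry the generators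
  commute with each element \<open>f\<close> of the algebra, and then the whole algebra commutes
  with \<open>f\<close>.\<close>

lemma aff_poisson_commutative_gen_alg:
  assumes "\<And>f g. f \<in> G \<Longrightarrow> g \<in> G \<Longrightarrow> f \<in> commuting g"
  shows "aff_poisson_commutative (gen_alg G)"
proof -
  have 1: "gen_alg G \<subseteq> commuting g" if "g \<in> G" for g
    using fun_algebra.gen_alg_subset[OF fun_algebra_commuting] assms that by blast
  have "gen_alg G \<subseteq> commuting f" if "f \<in> gen_alg G" for f
    using fun_algebra.gen_alg_subset[OF fun_algebra_commuting] 1 assms that commuting_sym by blast
  then show ?thesis
    unfolding aff_poisson_commutative_def using lp_bracket_commuting by blast
qed

lemma f_poly_commuting: "f_poly l xi \<in> commuting (f_poly k xi')"
  unfolding commuting_def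
  aff_diff_eqI[OF has_derivative_f_poly]
  using has_derivative_f_poly lp_form_f_grad by blast

section \<open>Index\<close>

lemma mult_outer: "A ** outer \<xi> b = outer (A *v \<xi>) b"
  by (simp add: outer_def matrix_matrix_mult_def matrix_vector_mult_def
      Finite_Cartesian_Product.vec_eq_iff sum_distrib_left sum_distrib_right mult_ac)

lemma outer_mult: "outer \<xi> b ** A = outer \<xi> (b v* A)"
  by (simp add: outer_def matrix_matrix_mult_def vector_matrix_mult_def
      Finite_Cartesian_Product.vec_eq_iff sum_distrib_left sum_distrib_right mult_ac)

lemma lp_form_outer_right:
  "lp_form x X (outer \<alpha> b, \<eta>) =
     b \<bullet> (fst x *v (fst X *v \<alpha>)) - b \<bullet> (fst X *v (fst x *v \<alpha>))
     + snd x \<bullet> (fst X *v \<eta>) - (b \<bullet> snd X) * (snd x \<bullet> \<alpha>)"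
proof -
  have "aff_bracket X (outer \<alpha> b, \<eta>) =
      (outer (fst X *v \<alpha>) b, fst X *v \<eta>) - (outer \<alpha> (b v* fst X), (b \<bullet> snd X) *\<^sub>R \<alpha>)"
    by (simp add: aff_bracket_def mult_outer outer_mult outer_mult_vec)
  then have "lp_form x X (outer \<alpha> b, \<eta>) = aff_pair x (outer (fst X *v \<alpha>) b, fst X *v \<eta>)
      - aff_pair x (outer \<alpha> (b v* fst X), (b \<bullet> snd X) *\<^sub>R \<alpha>)"
    by (simp only: lp_form_def aff_pair_inner inner_diff_right)
  then show ?thesis by (simp add: aff_pair_outer dot_lmul_matrix)
qed

text \<open>The form is nondegenerate at a diagonal matrix with distinct entries paired with \<open>(1, \<dots>, 1)\<close>.\<close>

lemma aff_index_eq_0: "aff_index TYPE('n::finite) = 0"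
proof -
  obtain d :: "'n \<Rightarrow> nat" where d: "inj d"
    using finite_imp_inj_to_nat_seg[of "UNIV :: 'n set"] by auto
  define x :: "'n aff" where
    "x = ((\<chi> p q. if p = q then real (d p) else 0), (\<chi> p. 1))"
  have x: "(fst x *v \<xi>) $ p = real (d p) * \<xi> $ p" "snd x \<bullet> \<xi> = (\<Sum>p\<in>UNIV. \<xi> $ p)" for \<xi> p
    by (simp_all add: x_def matrix_vector_mult_def inner_vec_def if_distrib[of "\<lambda>z. z * _"] cong: if_cong)
  have "X = 0" if X: "\<And>Y. lp_form x X Y = 0" for X
  proof -
    have ax: "(fst X *v (axis p 1)) $ q = fst X $ q $ p" for p q
      by (simp add: matrix_vector_mult_def axis_def if_distrib cong: if_cong)
    have mx: "fst x *v (axis p 1) = real (d p) *\<^sub>R axis p 1" for p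
      by (simp add: Finite_Cartesian_Product.vec_eq_iff x(1) axis_def)
    \<comment> \<open>The test element is an elementary matrix. The case \<open>q = p\<close> gives
      \<open>snd X = 0\<close>; distinct diagonal entries of \<open>fst x\<close> then kill the
      off-diagonal part.\<close>
    have entry: "(real (d q) - real (d p)) * fst X $ q $ p = snd X $ q" for p q
      using X[of "(outer (axis p 1) (axis q 1), 0)"]
      unfolding lp_form_outer_right mx
      by (simp add: inner_axis' ax x matrix_vector_mult_scaleR algebra_simps)
         (simp add: axis_def)
    have vec: "snd X $ q = 0" for q using entry[of q q] by simp
    have offdiag: "fst X $ q $ p = 0" if "q \<noteq> p" for p q
      using entry[of q p] vec injD[OF d, of q p] that by auto
    have diag: "fst X $ p $ p = 0" for p
    proof -
      \<comment> \<open>Testing against a vector yields a column sum of \<open>fst X\<close>, of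
        which only the diagonal entry remains.\<close>
      have "(\<Sum>q\<in>UNIV. fst X $ q $ p) = 0"
        using X[of "(outer 0 0, axis p 1)"] unfolding lp_form_outer_right by (simp add: x ax)
      then show ?thesis
        using offdiag by (subst (asm) sum.remove[of _ p]) auto
    qed
    have "fst X = 0" "snd X = 0"
      using vec diag offdiag by (auto simp: Finite_Cartesian_Product.vec_eq_iff) metis
    then show ?thesis by (simp add: prod_eq_iff)
  qed
  then have "{X. \<forall>Y. aff_pair x (aff_bracket X Y) = 0} = {0}"
    unfolding lp_form_def[symmetric] using linear_0[OF linear_lp_form_left] by blast
  then have "dim {X. \<forall>Y. aff_pair x (aff_bracket X Y) = 0} = 0" by simp
  then show ?thesis unfolding aff_index_def by (intro Least_eq_0 exI[of _ x]) (rule sym)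
qed

section \<open>Transcendence degree\<close>

text \<open>Upper triangular matrices with nonzero diagonal occur as Krylov matrices: take
  \<open>M = T\<inverse> S T\<close> with \<open>S\<close> the shift.\<close>

lemma exists_krow_eq:
  fixes T :: "nat \<Rightarrow> nat \<Rightarrow> real"
  assumes e: "bij_betw e {..<CARD('n)} (UNIV :: 'n::finite set)"
    and upper: "\<And>i j. j < i \<Longrightarrow> T i j = 0" and diag: "\<And>i. T i i \<noteq> 0"
  shows "\<exists>x :: 'n aff. \<forall>i<CARD('n). \<forall>j<CARD('n). krow x i $ e j = T i j"
proof -
  let ?n = "CARD('n)"
  define ix where "ix = inv_into {..<?n} e"
  have ix: "ix (e i) = i" if "i < ?n" for i
    using that e by (simp add: ix_def bij_betw_inv_into_left)
  have e_ix: "e (ix p) = p" "ix p < ?n" for p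
    using e bij_betw_inv_into_right[OF e, of p] bij_betw_apply[OF bij_betw_inv_into[OF e], of p]
    by (auto simp: ix_def)
  define A :: "real^'n^'n" where "A = (\<chi> p q. T (ix p) (ix q))"
  have reindex: "(\<Sum>p\<in>UNIV. f p) = (\<Sum>i<?n. f (e i))" for f :: "'n \<Rightarrow> real"
    using sum.reindex_bij_betw[OF e] by metis
  \<comment> \<open>Forward substitution: column \<open>j\<close> of \<open>x v* A\<close>
    determines \<open>x $ e j\<close> from the earlier entries.\<close>
  have "x = 0" if "x v* A = 0" for x
  proof -
    have "x $ e j = 0" if "j < ?n" for j
      using that
    proof (induction j rule: less_induct)
      case (less j)
      have "0 = (x v* A) $ e j" using \<open>x v* A = 0\<close> by simp
      also have "\<dots> = (\<Sum>i<?n. T i j * x $ e i)"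
        by (simp add: vector_matrix_mult_def A_def reindex ix less.prems mult.commute)
      also have "\<dots> = T j j * x $ e j + (\<Sum>i\<in>{..<?n} - {j}. T i j * x $ e i)"
        using less.prems by (subst sum.remove[of _ j]) auto
      also have "(\<Sum>i\<in>{..<?n} - {j}. T i j * x $ e i) = 0"
      proof (intro sum.neutral ballI)
        fix i assume "i \<in> {..<?n} - {j}"
        then show "T i j * x $ e i = 0"
          using less.IH[of i] upper[of j i] by (cases "i < j") auto
      qed
      finally show ?case using diag[of j] by simp
    qed
    then show ?thesis using e_ix by (metis Finite_Cartesian_Product.vec_eq_iff zero_index)
  qed
  then have "\<forall>x. Finite_Cartesian_Product.transpose A *v x = 0 \<longrightarrow> x = 0"
    by (simp add: transpose_matrix_vector)
  then obtain C where "C ** Finite_Cartesian_Product.transpose A = Finite_Cartesian_Product.mat 1"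
    using matrix_left_invertible_ker[of "Finite_Cartesian_Product.transpose A"] by blast
  then obtain B where B: "A ** B = Finite_Cartesian_Product.mat 1"
    by (metis matrix_transpose_mul Finite_Cartesian_Product.transpose_transpose Finite_Cartesian_Product.transpose_mat)
  define S :: "real^'n^'n" where "S = (\<chi> p q. if ix q = Suc (ix p) then 1 else 0)"
  \<comment> \<open>Since \<open>A ** B\<close> is the identity,
    \<open>A ** (B ** S ** A) = S ** A\<close>, so multiplication by \<open>fst x\<close> moves row
    \<open>i\<close> of \<open>A\<close> to the next row, starting from the first.\<close>
  define x :: "'n aff" where "x = (B ** S ** A, axis (e 0) 1 v* A)"
  have ax: "(axis p 1 v* C) $ q = C $ p $ q" for p q and C :: "real^'n^'n"
    by (simp add: vector_matrix_mult_def axis_def if_distrib[of "\<lambda>z. z * _"] cong: if_cong)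
  have krow: "krow x i = axis (e i) 1 v* A" if "i < ?n" for i
    using that
  proof (induction i)
    case 0
    then show ?case by (simp add: krow_0 x_def)
  next
    case (Suc i)
    have "axis (e i) 1 v* S = axis (e (Suc i)) 1"
      unfolding Finite_Cartesian_Product.vec_eq_iff ax
      using Suc.prems e_ix by (auto simp: S_def ix axis_def) metis
    moreover have "krow x (Suc i) = axis (e i) 1 v* (A ** (B ** S ** A))"
      using Suc by (simp add: krow_Suc x_def vector_matrix_mul_assoc)
    moreover have "A ** (B ** S ** A) = S ** A"
      using B by (metis matrix_mul_assoc matrix_mul_lid)
    ultimately show ?case by (simp flip: vector_matrix_mul_assoc)
  qed
  show ?thesis
    using krow by (intro exI[of _ x]) (simp add: ax A_def ix)
qed

section \<open>Lower bound: independent minors\<close>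

text \<open>The first \<open>Suc k\<close> of these vectors select the minor of the Krylov matrix on
  rows \<open>0..k\<close> and columns \<open>0..k-1, j\<close>.\<close>

definition minor_vecs :: "(nat \<Rightarrow> 'n) \<Rightarrow> nat \<Rightarrow> nat \<Rightarrow> nat \<Rightarrow> real^'n" where
  "minor_vecs e j k c = axis (e (if c < k then c else j)) 1"

text \<open>On an upper triangular matrix such a minor is the product of the first \<open>k\<close>
  diagonal entries and the entry in row \<open>k\<close>, column \<open>j\<close>, so the entries
  can be solved for row by row.\<close>

lemma exists_f_poly_eq:
  fixes z :: "nat \<times> nat \<Rightarrow> real"
  assumes e: "bij_betw e {..<CARD('n)} (UNIV :: 'n::finite set)" and z: "\<And>p. z p > 0"
  shows "\<exists>x :: 'n aff. \<forall>j<CARD('n). \<forall>k\<le>j. f_poly (Suc k) (minor_vecs e j k) x = z (j, k)"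
proof -
  let ?n = "CARD('n)"
  \<comment> \<open>\<open>w k\<close> is the value prescribed for the leading minor of size
    \<open>k\<close>, with 1 for the empty one.\<close>
  define w where "w k = (if k = 0 then 1 else z (k - 1, k - 1))" for k
  define T where "T i j = (if i \<le> j then z (j, i) / w i else 0)" for i j
  have w: "w k > 0" for k using z by (simp add: w_def)
  have diag: "(\<Prod>i<k. T i i) = w k" for k
  proof (induction k)
    case (Suc k)
    then show ?case using w[of k] by (simp add: T_def) (simp add: w_def)
  qed (simp add: w_def)
  have "T i i \<noteq> 0" for i
    using z[of "(i, i)"] w[of i] by (simp add: T_def)
  then have "\<exists>x :: 'n aff. \<forall>i<?n. \<forall>j<?n. krow x i $ e j = T i j"
    by (intro exists_krow_eq[OF e]) (simp_all add: T_def)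
  then obtain x :: "'n aff" where x: "\<And>i j. i < ?n \<Longrightarrow> j < ?n \<Longrightarrow> krow x i $ e j = T i j"
    by blast
  have "f_poly (Suc k) (minor_vecs e j k) x = z (j, k)" if "j < ?n" "k \<le> j" for j k
  proof -
    have "f_poly (Suc k) (minor_vecs e j k) x = det_k (Suc k) (\<lambda>i c. T i (if c < k then c else j))"
      unfolding f_poly_krow minor_vecs_def inner_axis
      using that by (intro det_k_cong) (auto simp: x)
    also have "\<dots> = (\<Prod>i<Suc k. T i (if i < k then i else j))"
      by (rule det_k_upper_triangular) (auto simp: T_def)
    also have "\<dots> = (\<Prod>i<k. T i i) * T k j" by simp
    also have "\<dots> = z (j, k)" unfolding diag using that w[of k] by (simp add: T_def)
    finally show ?thesis .
  qed
  then show ?thesis by blast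
qed

text \<open>Positions on and above the diagonal, column index first.\<close>

definition tri :: "nat \<Rightarrow> (nat \<times> nat) set" where
  "tri n = Sigma {..<n} (\<lambda>j. {..j})"

lemma finite_tri: "finite (tri n)"
  by (simp add: tri_def)

lemma card_tri: "2 * card (tri n) = n * n + n"
proof -
  have "card (tri n) = (\<Sum>j<n. Suc j)" by (simp add: tri_def)
  moreover have "2 * (\<Sum>j<n. Suc j) = n * n + n" by (induction n) auto
  ultimately show ?thesis by simp
qed

abbreviation f_polys :: "('n::finite aff \<Rightarrow> real) set" where
  "f_polys \<equiv> {f_poly k xi :: 'n aff \<Rightarrow> real | k xi. 1 \<le> k \<and> k \<le> CARD('n)}"

lemma f_polys_alg_indep:
  "\<exists>gs. (\<forall>i<card (tri CARD('n)). gs i \<in> (f_polys :: ('n::finite aff \<Rightarrow> real) set)) \<and>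
     alg_indep (card (tri CARD('n))) gs"
proof -
  let ?n = "CARD('n)" let ?N = "card (tri ?n)"
  obtain e :: "nat \<Rightarrow> 'n" where e: "bij_betw e {..<?n} UNIV"
    using ex_bij_betw_nat_finite[of "UNIV :: 'n set"] by (auto simp: atLeast0LessThan)
  obtain h where h: "bij_betw h {..<?N} (tri ?n)"
    using ex_bij_betw_nat_finite[OF finite_tri, of ?n] by (auto simp: atLeast0LessThan)
  define gs :: "nat \<Rightarrow> 'n aff \<Rightarrow> real" where
    "gs i = f_poly (Suc (snd (h i))) (minor_vecs e (fst (h i)) (snd (h i)))" for i
  have hi: "fst (h i) < ?n" "snd (h i) \<le> fst (h i)" if "i < ?N" for i
    using bij_betw_apply[OF h, of i] that by (auto simp: tri_def)
  have "gs i \<in> f_polys" if "i < ?N" for i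
    unfolding gs_def using hi[OF that] by fastforce
  moreover have "alg_indep ?N gs"
  proof (rule alg_indepI_positive)
    fix y :: "nat \<Rightarrow> real" assume "\<And>i. y i > 0"
    then have "\<exists>x :: 'n aff. \<forall>j<?n. \<forall>k\<le>j.
        f_poly (Suc k) (minor_vecs e j k) x = y (inv_into {..<?N} h (j, k))"
      by (intro exists_f_poly_eq[OF e]) auto
    then obtain x :: "'n aff" where x: "\<And>j k. j < ?n \<Longrightarrow> k \<le> j \<Longrightarrow>
        f_poly (Suc k) (minor_vecs e j k) x = y (inv_into {..<?N} h (j, k))"
      by blast
    have "gs i x = y i" if "i < ?N" for i
      using x[OF hi[OF that]] bij_betw_inv_into_left[OF h, of i] that by (simp add: gs_def)
    then show "\<exists>x. \<forall>i<?N. gs i x = y i" by blast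
  qed
  ultimately show ?thesis by blast
qed

section \<open>Upper bound: restriction to triangular matrices\<close>

text \<open>\<open>f_poly\<close> as a function of the Krylov matrix, with columns enumerated by \<open>e\<close>.\<close>

definition f_hat :: "(nat \<Rightarrow> 'n) \<Rightarrow> nat \<Rightarrow> (nat \<Rightarrow> real^'n::finite) \<Rightarrow> (nat \<Rightarrow> nat \<Rightarrow> real) \<Rightarrow> real" where
  "f_hat e k xi W = det_k k (\<lambda>i j. \<Sum>c<CARD('n). W i c * xi j $ e c)"

abbreviation f_hats :: "(nat \<Rightarrow> 'n::finite) \<Rightarrow> ((nat \<Rightarrow> nat \<Rightarrow> real) \<Rightarrow> real) set" where
  "f_hats e \<equiv> {f_hat e k xi | k xi. 1 \<le> k \<and> k \<le> CARD('n)}"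

lemma f_poly_f_hat:
  assumes e: "bij_betw e {..<CARD('n)} (UNIV :: 'n::finite set)"
  shows "f_poly k xi x = f_hat e k xi (\<lambda>i c. krow (x :: 'n aff) i $ e c)"
  unfolding f_poly_krow f_hat_def inner_vec_def
  using sum.reindex_bij_betw[OF e] by (intro det_k_cong) (simp flip: sum.reindex_bij_betw[OF e])

text \<open>The lift \<open>H\<close> is defined on arbitrary matrices, not only on Krylov matrices
  of points \<open>x\<close>, so it can be restricted to triangular ones.\<close>

lemma gen_alg_lift:
  assumes e: "bij_betw e {..<CARD('n)} (UNIV :: 'n::finite set)" and "g \<in> gen_alg f_polys"
  shows "\<exists>H\<in>alg_hull (f_hats e). \<forall>x :: 'n aff. g x = H (\<lambda>i c. krow x i $ e c)"
proof -
  let ?A = "{g. \<exists>H\<in>alg_hull (f_hats e). \<forall>x :: 'n aff. g x = H (\<lambda>i c. krow x i $ e c)}"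
  interpret hull: fun_algebra "alg_hull (f_hats e)" by (rule fun_algebra_alg_hull)
  have "fun_algebra ?A"
  proof
    show "(\<lambda>x. c) \<in> ?A" for c
      using hull.const[of c] by (intro CollectI bexI[of _ "\<lambda>_. c"]) auto
  next
    fix f g assume "f \<in> ?A" "g \<in> ?A"
    then obtain F G where FG: "F \<in> alg_hull (f_hats e)" "G \<in> alg_hull (f_hats e)"
      "\<forall>x. f x = F (\<lambda>i c. krow x i $ e c)" "\<forall>x. g x = G (\<lambda>i c. krow x i $ e c)" by blast
    show "(\<lambda>x. f x + g x) \<in> ?A"
      using FG hull.add[OF FG(1,2)] by (intro CollectI bexI[of _ "\<lambda>W. F W + G W"] allI) auto
    show "(\<lambda>x. f x * g x) \<in> ?A"
      using FG hull.mult[OF FG(1,2)] by (intro CollectI bexI[of _ "\<lambda>W. F W * G W"] allI) auto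
  qed
  moreover have "f_polys \<subseteq> ?A"
  proof
    fix f :: "'n aff \<Rightarrow> real" assume "f \<in> f_polys"
    then obtain k xi where f: "f = f_poly k xi" "f_hat e k xi \<in> f_hats e" by blast
    show "f \<in> ?A"
      unfolding f(1) using f_poly_f_hat[OF e] subsetD[OF subset_alg_hull f(2)]
      by (intro CollectI bexI[of _ "f_hat e k xi"] allI)
  qed
  ultimately show ?thesis using fun_algebra.gen_alg_subset assms(2) by blast
qed

text \<open>This algebra and the next two carry properties of the generators \<open>f_hats\<close>
  over to \<open>alg_hull\<close>.\<close>

lemma fun_algebra_eq_at: "fun_algebra {H. H a = H b}"
  by standard auto

lemma fun_algebra_continuous: "fun_algebra {H. continuous_on UNIV (\<lambda>t :: real. H (w t))}"
  by standard (auto intro: continuous_intros)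

lemma fun_algebra_poly_le_comp: "fun_algebra {H. \<exists>K. poly_le N K (\<lambda>y. H (w y))}"
proof -
  interpret fun_algebra "{P. \<exists>K. poly_le N K P}" by (rule fun_algebra_poly_le)
  show ?thesis using const add mult by unfold_locales auto
qed

text \<open>Row \<open>i\<close> comes from \<open>LU_row\<close> with the leading minor of size
  \<open>i\<close> as pivot, so sizes below \<open>n\<close> suffice.\<close>

lemma LU_decomposition:
  assumes "\<And>i. i < n \<Longrightarrow> det_k i W \<noteq> 0"
  obtains L where "\<And>i. i < n \<Longrightarrow> L i i = 1" "\<And>i j. i < j \<Longrightarrow> L i j = (0::real)"
    "\<And>i c. i < n \<Longrightarrow> c < i \<Longrightarrow> (\<Sum>r<n. L i r * W r c) = 0"
proof -
  have "\<forall>i\<in>{..<n}. \<exists>l. l i = 1 \<and> (\<forall>c<i. (\<Sum>r<Suc i. l r * W r c) = (0::real))"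
    using assms LU_row by (metis lessThan_iff)
  from bchoice[OF this] obtain l where
    l: "\<forall>i\<in>{..<n}. l i i = 1 \<and> (\<forall>c<i. (\<Sum>r<Suc i. l i r * W r c) = (0::real))" ..
  \<comment> \<open>\<open>LU_row\<close> leaves the entries beyond the diagonal open; setting them
    to 0 lets the sum run over all \<open>r < n\<close>.\<close>
  define L where "L i r = (if r \<le> i then l i r else 0)" for i r
  have "(\<Sum>r<n. L i r * W r c) = (\<Sum>r<Suc i. l i r * W r c)" if "i < n" for i c
    using that by (intro sum.mono_neutral_cong_right) (auto simp: L_def)
  then show ?thesis
    using l by (intro that[of L]) (auto simp: L_def simp del: sum.lessThan_Suc)
qed

text \<open>The first \<open>k\<close> rows of the product involve only the leading \<open>k\<close>
  by \<open>k\<close> block of \<open>L\<close>, and applying the vectors \<open>xi j\<close> on the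
  right commutes with multiplying by that block.\<close>

lemma f_hat_unipotent_mult:
  assumes "k \<le> n" "\<And>i. i < n \<Longrightarrow> L i i = 1" "\<And>i j. i < j \<Longrightarrow> L i j = 0"
    and T: "\<And>i c. i < k \<Longrightarrow> c < CARD('n) \<Longrightarrow> T i c = (\<Sum>r<n. L i r * W r c)"
  shows "f_hat (e :: nat \<Rightarrow> 'n::finite) k xi T = f_hat e k xi W"
proof -
  have T': "T i c = (\<Sum>r<k. L i r * W r c)" if "i < k" "c < CARD('n)" for i c
    unfolding T[OF that] using assms(1,3) that by (intro sum.mono_neutral_right) auto
  have "f_hat e k xi T = det_k k (\<lambda>i j. \<Sum>r<k. L i r * (\<Sum>c<CARD('n). W r c * xi j $ e c))"
    unfolding f_hat_def
  proof (rule det_k_cong)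
    fix i j assume "i < k"
    have "(\<Sum>c<CARD('n). T i c * xi j $ e c) = (\<Sum>c<CARD('n). \<Sum>r<k. L i r * (W r c * xi j $ e c))"
      using T'[OF \<open>i < k\<close>] by (simp add: sum_distrib_right mult.assoc)
    also have "\<dots> = (\<Sum>r<k. \<Sum>c<CARD('n). L i r * (W r c * xi j $ e c))" by (rule sum.swap)
    finally show "(\<Sum>c<CARD('n). T i c * xi j $ e c) = (\<Sum>r<k. L i r * (\<Sum>c<CARD('n). W r c * xi j $ e c))"
      by (simp add: sum_distrib_left)
  qed
  also have "\<dots> = f_hat e k xi W"
    unfolding f_hat_def using assms by (intro det_k_unipotent_mult) auto
  finally show ?thesis .
qed

definition tri_mat :: "nat \<Rightarrow> (nat \<times> nat \<Rightarrow> nat) \<Rightarrow> (nat \<Rightarrow> real) \<Rightarrow> nat \<Rightarrow> nat \<Rightarrow> real" where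
  "tri_mat n h y i j = (if (j, i) \<in> tri n then y (h (j, i)) else 0)"

text \<open>The triangular matrix is constructed from \<open>W\<close> alone, so one
  \<open>y\<close> serves all \<open>H\<close> at once.\<close>

lemma alg_hull_f_hats_eq_tri_mat:
  assumes W: "\<And>i. i < CARD('n) \<Longrightarrow> det_k i W \<noteq> 0" and h: "inj_on h (tri CARD('n))"
  shows "\<exists>y. \<forall>H\<in>alg_hull (f_hats (e :: nat \<Rightarrow> 'n::finite)). H W = H (tri_mat CARD('n) h y)"
proof -
  let ?n = "CARD('n)"
  obtain L where L: "\<And>i. i < ?n \<Longrightarrow> L i i = 1" "\<And>i j. i < j \<Longrightarrow> L i j = (0::real)"
    "\<And>i c. i < ?n \<Longrightarrow> c < i \<Longrightarrow> (\<Sum>r<?n. L i r * W r c) = 0"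
    using LU_decomposition[of ?n W] W by blast
  \<comment> \<open>\<open>y\<close> stores the upper triangular entries of the product of
    \<open>L\<close> and \<open>W\<close>.\<close>
  define y where "y m = (case inv_into (tri ?n) h m of (j, i) \<Rightarrow> (\<Sum>r<?n. L i r * W r j))" for m
  have T: "tri_mat ?n h y i c = (\<Sum>r<?n. L i r * W r c)" if "i < ?n" "c < ?n" for i c
    using that L(3) h by (auto simp: tri_mat_def y_def tri_def)
  have "f_hats e \<subseteq> {H. H W = H (tri_mat ?n h y)}"
    using f_hat_unipotent_mult[of _ ?n L "tri_mat ?n h y" W] L(1,2) T by fastforce
  then have "alg_hull (f_hats e) \<subseteq> {H. H W = H (tri_mat ?n h y)}"
    by (rule alg_hull_subset[OF fun_algebra_eq_at])
  then show ?thesis by blast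
qed

text \<open>The shift \<open>W + t I\<close> has nonzero leading minors for all but finitely many \<open>t\<close>; let
  \<open>t\<close> tend to \<open>0\<close>.\<close>

lemma alg_hull_f_hats_eq_0:
  assumes H: "H \<in> alg_hull (f_hats (e :: nat \<Rightarrow> 'n::finite))" and h: "inj_on h (tri CARD('n))"
    and zero: "\<And>y. H (tri_mat CARD('n) h y) = 0"
  shows "H W = 0"
proof -
  define w where "w t = (\<lambda>i j. W i j + (if i = j then t else 0))" for t :: real
  define F where "F = (\<Union>i<CARD('n). {t. det_k i (w t) = 0})"
  have F: "finite F" unfolding F_def w_def using finite_det_k_shift by blast
  \<comment> \<open>Away from \<open>F\<close> the matrix \<open>w t\<close> admits elimination, so
    \<open>H (w t)\<close> is a value of \<open>H\<close> at a triangular matrix.\<close>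
  have nz: "{t. H (w t) \<noteq> 0} \<subseteq> F"
    using alg_hull_f_hats_eq_tri_mat[OF _ h, of _ e] H zero by (fastforce simp: F_def)
  have "continuous_on UNIV (\<lambda>t. w t i c)" for i c
    by (cases "i = c") (auto simp: w_def intro: continuous_intros)
  then have "continuous_on UNIV (\<lambda>t. f_hat e k xi (w t))" for k xi
    unfolding f_hat_def det_k_def by (intro continuous_intros)
  then have "alg_hull (f_hats e) \<subseteq> {H. continuous_on UNIV (\<lambda>t. H (w t))}"
    by (intro alg_hull_subset[OF fun_algebra_continuous]) auto
  then have "continuous_on UNIV (\<lambda>t. H (w t))" using H by blast
  \<comment> \<open>The nonvanishing set is open and finite, hence empty.\<close>
  then have "open {t. H (w t) \<noteq> 0}"
    by (intro open_Collect_neq continuous_intros)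
  then have "{t. H (w t) \<noteq> 0} = {}"
    using finite_imp_not_open finite_subset[OF nz F] by blast
  then have "H (w 0) = 0" by blast
  then show ?thesis by (simp add: w_def cong: if_cong)
qed

text \<open>Too many elements satisfy a polynomial relation on triangular matrices. The relation
  evaluated at the lifts lies in the hull itself, so it holds at all matrices, in particular at the
  Krylov ones.\<close>

lemma trdeg_f_polys_le:
  fixes gs :: "nat \<Rightarrow> 'n::finite aff \<Rightarrow> real"
  assumes gs: "\<And>i. i < m \<Longrightarrow> gs i \<in> gen_alg f_polys" and ind: "alg_indep m gs"
  shows "m \<le> card (tri CARD('n))"
proof (rule ccontr)
  let ?n = "CARD('n)" let ?N = "card (tri ?n)"
  assume "\<not> m \<le> ?N"
  obtain e :: "nat \<Rightarrow> 'n" where e: "bij_betw e {..<?n} UNIV"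
    using ex_bij_betw_nat_finite[of "UNIV :: 'n set"] by (auto simp: atLeast0LessThan)
  obtain h where h: "bij_betw h (tri ?n) {..<?N}"
    using ex_bij_betw_finite_nat[OF finite_tri, of ?n] by (auto simp: atLeast0LessThan)
  have "\<forall>i\<in>{..<m}. \<exists>H. H \<in> alg_hull (f_hats e) \<and> (\<forall>x. gs i x = H (\<lambda>i c. krow x i $ e c))"
    using gen_alg_lift[OF e] gs by blast
  from bchoice[OF this] obtain H where
    H: "\<forall>i\<in>{..<m}. H i \<in> alg_hull (f_hats e) \<and> (\<forall>x. gs i x = H i (\<lambda>i c. krow x i $ e c))" ..
  interpret tri: fun_algebra "{H. \<exists>K. poly_le ?N K (\<lambda>y. H (tri_mat ?n h y))}"
    by (rule fun_algebra_poly_le_comp)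
  have entry: "(\<lambda>W. W i c) \<in> {H. \<exists>K. poly_le ?N K (\<lambda>y. H (tri_mat ?n h y))}" for i c
    using poly_le_coord[of "h (c, i)" ?N] bij_betw_apply[OF h, of "(c, i)"] poly_le_const[of ?N 0 0]
    by (cases "(c, i) \<in> tri ?n") (auto simp: tri_mat_def)
  have "f_hat e k xi \<in> {H. \<exists>K. poly_le ?N K (\<lambda>y. H (tri_mat ?n h y))}" for k xi
    unfolding f_hat_def[abs_def] by (intro tri.det_k tri.sum tri.mult tri.const entry)
  then have poly: "\<exists>K. poly_le ?N K (\<lambda>y. H i (tri_mat ?n h y))" if "i < m" for i
    using alg_hull_subset[OF fun_algebra_poly_le_comp, of "f_hats e"] H that by blast
  obtain c where c: "c \<in> mpoly_coeffs m" "\<exists>\<alpha>. c \<alpha> \<noteq> 0"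
    "\<And>y. mpoly_eval m c (\<lambda>i y. H i (tri_mat ?n h y)) y = 0"
    using algebraic_dependence[of ?N m "\<lambda>i y. H i (tri_mat ?n h y)"] poly \<open>\<not> m \<le> ?N\<close> by auto
  interpret hull: fun_algebra "alg_hull (f_hats e)" by (rule fun_algebra_alg_hull)
  have "mpoly_eval m c H \<in> alg_hull (f_hats e)" using H by (intro hull.mpoly_eval) auto
  then have zero: "mpoly_eval m c H W = 0" for W
  proof (rule alg_hull_f_hats_eq_0[OF _ bij_betw_imp_inj_on[OF h]])
    show "mpoly_eval m c H (tri_mat ?n h y) = 0" for y
      using c(3)[of y] unfolding mpoly_eval_def .
  qed
  have gs_eq: "gs i x = H i (\<lambda>i c. krow x i $ e c)" if "i < m" for i x
    using H that by blast
  have "mpoly_eval m c gs x = mpoly_eval m c H (\<lambda>i c. krow x i $ e c)" for x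
    unfolding mpoly_eval_def by (simp add: gs_eq)
  then show False using ind c(1,2) zero unfolding alg_indep_def by auto
qed

lemma trdeg_f_polys:
  "trdeg (gen_alg (f_polys :: ('n::finite aff \<Rightarrow> real) set)) = enat (card (tri CARD('n)))"
  unfolding trdeg_def
proof (rule antisym)
  show "Sup {enat m |m. \<exists>gs. (\<forall>i<m. gs i \<in> gen_alg (f_polys :: ('n aff \<Rightarrow> real) set)) \<and> alg_indep m gs}
      \<le> enat (card (tri CARD('n)))"
  proof (rule Sup_least)
    fix u assume "u \<in> {enat m |m. \<exists>gs. (\<forall>i<m. gs i \<in> gen_alg (f_polys :: ('n aff \<Rightarrow> real) set)) \<and> alg_indep m gs}"
    then obtain m and gs :: "nat \<Rightarrow> 'n aff \<Rightarrow> real" where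
      "u = enat m" "\<And>i. i < m \<Longrightarrow> gs i \<in> gen_alg f_polys" "alg_indep m gs" by blast
    then show "u \<le> enat (card (tri CARD('n)))"
      using trdeg_f_polys_le[of m gs] by (simp only: enat_ord_simps)
  qed
  show "enat (card (tri CARD('n)))
      \<le> Sup {enat m |m. \<exists>gs. (\<forall>i<m. gs i \<in> gen_alg (f_polys :: ('n aff \<Rightarrow> real) set)) \<and> alg_indep m gs}"
    using f_polys_alg_indep[where 'n = 'n] subset_gen_alg[of f_polys] by (intro Sup_upper) blast
qed

theorem theorem6:
  fixes n_type :: "'n::finite itself"
  shows "(\<forall>k l. 1 \<le> k \<and> k \<le> CARD('n) \<and> 1 \<le> l \<and> l \<le> CARD('n) \<longrightarrow>
           (\<forall>(xi :: nat \<Rightarrow> real^'n) xi'. \<forall>x :: 'n aff.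
              lp_bracket (f_poly l xi) (f_poly k xi') x = 0))
       \<and> aff_complete (gen_alg {f_poly k xi :: 'n aff \<Rightarrow> real | k xi. 1 \<le> k \<and> k \<le> CARD('n)})"
proof -
  have "aff_poisson_commutative (gen_alg (f_polys :: ('n aff \<Rightarrow> real) set))"
    using f_poly_commuting by (intro aff_poisson_commutative_gen_alg) blast
  moreover have "2 * enat (card (tri CARD('n))) = enat (DIM('n aff) + aff_index TYPE('n))"
    using card_tri[of "CARD('n)"] by (simp add: aff_index_eq_0 numeral_eq_enat)
  ultimately show ?thesis
    unfolding aff_complete_def trdeg_f_polys using lp_bracket_f_poly by blast
qed

end
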